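(* Let $(\mathfrak g,\pi)$ and $(\mathfrak h,\mu)$ be finite-dimensional real $3$-Lie algebras and let $f:\mathfrak g\to\mathfrak h$ be a $3$-Lie algebra morphism. If $H^1(f)=0$, then there exist an open neighborhood $U\subset\mathrm{Hom}(\mathfrak g,\mathfrak h)$ of $f$ and a smooth map $p:U\to\mathrm{InnAut}(\mathfrak h)$ such that $p(f')\cdot f=f'$ for every $3$-Lie algebra morphism $f'\in U$.
   Context: A $3$-Lie algebra is a vector space $\mathfrak g$ with a linear map $\pi:\wedge^3\mathfrak g\to\mathfrak g$ such that $\pi(x_1,x_2,\pi(x_3,x_4,x_5))=\pi(\pi(x_1,x_2,x_3),x_4,x_5)+\pi(x_3,\pi(x_1,x_2,x_4),x_5)+\pi(x_3,x_4,\pi(x_1,x_2,x_5))$ for all $x_i\in\mathfrak g$. A $3$-Lie algebra morphism $(\mathfrak g,\pi)\to(\mathfrak h,\mu)$ is a linear map $f$ with $f(\pi(x,y,z))=\mu(f(x),f(y),f(z))$. Cohomology of $f$ in degree $1$: $C^0(f)=(\wedge^2\mathfrak g)\oplus(\wedge^2\mathfrak h)$, $C^1(f)=\mathrm{Hom}(\mathfrak g,\mathfrak h)$, $C^2(f)=\mathrm{Hom}(\wedge^3\mathfrak g,\mathfrak h)$. For $\mathcal X=\sum_jx_j\wedge y_j\in\wedge^2\mathfrak g$, $\mathcal U=\sum_iu_i\wedge v_i\in\wedge^2\mathfrak h$, $z\in\mathfrak g$, $\delta(\mathcal X,\mathcal U)(z)=\sum_i\mu(u_i,v_i,f(z))-\sum_jf(\pi(x_j,y_j,z))$.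 For $\theta\in C^1(f)$, $\delta(\theta)(x\wedge y,z)=-\theta(\pi(x,y,z))+\mu(f(x),f(y),\theta(z))+\mu(\theta(x),f(y),f(z))+\mu(f(x),\theta(y),f(z))$. Then $H^1(f)=Z^1(f)/B^1(f)$ with $Z^1(f)=\ker(\delta|_{C^1(f)})$ and $B^1(f)=\delta(C^0(f))$. For $\mathcal U=\sum_iu_i\wedge v_i\in\wedge^2\mathfrak h$ let $\mathrm{ad}_{\mathcal U}=\sum_i\mu(u_i,v_i,\cdot)$; $\mathrm{InnDer}(\mathfrak h)=\{\mathrm{ad}_{\mathcal U}\mid\mathcal U\in\wedge^2\mathfrak h\}$ is a Lie subalgebra of $\mathfrak{gl}(\mathfrak h)$. $\mathrm{InnAut}(\mathfrak h)$ denotes the connected, simply connected Lie group with Lie algebra $\mathrm{InnDer}(\mathfrak h)$; it acts linearly on $\mathfrak h$ (by $3$-Lie algebra automorphisms) through the homomorphism $\mathrm{InnAut}(\mathfrak h)\to\mathrm{GL}(\mathfrak h)$ integrating the inclusion $\mathrm{InnDer}(\mathfrak h)\subset\mathfrak{gl}(\mathfrak h)$. It acts on $\mathrm{Hom}(\mathfrak g,\mathfrak h)$ by $B\cdot g=B\circ g$. *)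

theory Defs
  imports "HOL-Analysis.Analysis" "HOL-Algebra.Group"
begin

section \<open>Exterior squares\<close>

definition alternating_bilinear ::
  "('a::real_vector \<Rightarrow> 'a \<Rightarrow> 'w::real_vector) \<Rightarrow> bool" where
  "alternating_bilinear \<beta> \<longleftrightarrow>
     (\<forall>x. linear (\<beta> x)) \<and> (\<forall>y. linear (\<lambda>x. \<beta> x y)) \<and> (\<forall>x. \<beta> x x = 0)"

definition sum_pairs :: "('a \<Rightarrow> 'a \<Rightarrow> 'w::real_vector) \<Rightarrow> ('a \<times> 'a) list \<Rightarrow> 'w" where
  "sum_pairs \<beta> xs = (\<Sum>(x, y)\<leftarrow>xs. \<beta> x y)"

text \<open>
  A list of pairs stands for the formal sum of the bivectors \<open>x \<and> y\<close>.  Two formal sums agree in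
  the exterior square iff no alternating bilinear form separates them.
\<close>

definition bivector_rel :: "('a::real_vector \<times> 'a) list \<Rightarrow> ('a \<times> 'a) list \<Rightarrow> bool" where
  "bivector_rel xs ys \<longleftrightarrow>
     (\<forall>\<beta> :: 'a \<Rightarrow> 'a \<Rightarrow> real. alternating_bilinear \<beta> \<longrightarrow> sum_pairs \<beta> xs = sum_pairs \<beta> ys)"

lemma equivp_bivector_rel: "equivp bivector_rel"
  by (rule equivpI) (auto simp: reflp_def symp_def transp_def bivector_rel_def)

quotient_type (overloaded) 'a bivector = "('a::real_vector \<times> 'a) list" / bivector_rel
  by (rule equivp_bivector_rel)

definition scale_pairs :: "real \<Rightarrow> ('a::real_vector \<times> 'a) list \<Rightarrow> ('a \<times> 'a) list" where
  "scale_pairs c = map (\<lambda>(x, y). (c *\<^sub>R x, y))"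

lemma sum_pairs_Nil: "sum_pairs \<beta> [] = 0"
  by (simp add: sum_pairs_def)

lemma sum_pairs_append: "sum_pairs \<beta> (xs @ ys) = sum_pairs \<beta> xs + sum_pairs \<beta> ys"
  by (simp add: sum_pairs_def)

lemma sum_pairs_scale:
  assumes "alternating_bilinear \<beta>"
  shows "sum_pairs \<beta> (scale_pairs c xs) = c *\<^sub>R sum_pairs \<beta> xs"
proof (induction xs)
  case Nil
  then show ?case by (simp add: sum_pairs_def scale_pairs_def)
next
  case (Cons p xs)
  have "\<beta> (c *\<^sub>R x) y = c *\<^sub>R \<beta> x y" for x y
    using assms linear_cmul[of "\<lambda>x. \<beta> x y"] by (auto simp: alternating_bilinear_def)
  with Cons show ?case
    by (cases p) (simp add: sum_pairs_def scale_pairs_def scaleR_add_right)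
qed

instantiation bivector :: (real_vector) real_vector
begin

lift_definition zero_bivector :: "'a bivector" is "[]" .

lift_definition plus_bivector :: "'a bivector \<Rightarrow> 'a bivector \<Rightarrow> 'a bivector" is "(@)"
  by (auto simp: bivector_rel_def sum_pairs_append)

lift_definition scaleR_bivector :: "real \<Rightarrow> 'a bivector \<Rightarrow> 'a bivector"
  is scale_pairs
  by (simp add: bivector_rel_def sum_pairs_scale)

definition uminus_bivector :: "'a bivector \<Rightarrow> 'a bivector" where
  "uminus_bivector X = (- 1) *\<^sub>R X"

definition minus_bivector :: "'a bivector \<Rightarrow> 'a bivector \<Rightarrow> 'a bivector" where
  "minus_bivector X Y = X + (- Y)"

instance
proof
  fix X Y Z :: "'a bivector" and a b :: real
  show "X + Y + Z = X + (Y + Z)"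
    by transfer (simp add: bivector_rel_def)
  show "X + Y = Y + X"
    by transfer (simp add: bivector_rel_def sum_pairs_append)
  show "0 + X = X"
    by transfer (simp add: bivector_rel_def)
  show "- X + X = 0"
    unfolding uminus_bivector_def
    by transfer (simp add: bivector_rel_def sum_pairs_append sum_pairs_scale sum_pairs_Nil)
  show "X - Y = X + - Y"
    by (simp add: minus_bivector_def)
  show "a *\<^sub>R (X + Y) = a *\<^sub>R X + a *\<^sub>R Y"
    by transfer
      (simp add: bivector_rel_def sum_pairs_append sum_pairs_scale distrib_left)
  show "(a + b) *\<^sub>R X = a *\<^sub>R X + b *\<^sub>R X"
    by transfer
      (simp add: bivector_rel_def sum_pairs_append sum_pairs_scale distrib_right)
  show "a *\<^sub>R b *\<^sub>R X = (a * b) *\<^sub>R X"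
    by transfer (simp add: bivector_rel_def sum_pairs_scale)
  show "1 *\<^sub>R X = X"
    by transfer (simp add: bivector_rel_def sum_pairs_scale)
qed

end

lift_definition wedge :: "'a::real_vector \<Rightarrow> 'a \<Rightarrow> 'a bivector" is "\<lambda>x y. [(x, y)]" .

text \<open>
  The linear extension of an alternating bilinear map along \<open>wedge\<close>, computed on an arbitrary
  representative; the next two lemmas show that it is well defined and linear.
\<close>

definition ext_bivector ::
  "('a::real_vector \<Rightarrow> 'a \<Rightarrow> 'w::real_vector) \<Rightarrow> 'a bivector \<Rightarrow> 'w" where
  "ext_bivector \<beta> X = sum_pairs \<beta> (rep_bivector X)"

lemma ext_bivector_abs:
  fixes \<beta> :: "'a::real_vector \<Rightarrow> 'a \<Rightarrow> 'w::real_vector"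
  assumes "alternating_bilinear \<beta>"
  shows "ext_bivector \<beta> (abs_bivector xs) = (\<Sum>(x, y)\<leftarrow>xs. \<beta> x y)"
proof -
  define ys where "ys = rep_bivector (abs_bivector xs)"
  have rel: "bivector_rel ys xs"
    unfolding ys_def by (rule Quotient3_rep_abs[OF Quotient3_bivector])
      (simp add: bivector_rel_def)
  have "sum_pairs \<beta> ys = sum_pairs \<beta> xs"
  proof (rule ccontr)
    define w where "w = sum_pairs \<beta> ys - sum_pairs \<beta> xs"
    assume "sum_pairs \<beta> ys \<noteq> sum_pairs \<beta> xs"
    then have "independent {w}" by (simp add: w_def)
    then obtain l :: "'w \<Rightarrow> real" where l: "linear l" "l w = 1"
      using linear_independent_extend[of "{w}" "\<lambda>_. 1"] by auto
    have comp: "sum_pairs (\<lambda>x y. l (\<beta> x y)) zs = l (sum_pairs \<beta> zs)" for zs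
      by (induction zs) (auto simp: sum_pairs_def linear_0[OF l(1)] linear_add[OF l(1)])
    have "alternating_bilinear (\<lambda>x y. l (\<beta> x y))"
      using assms linear_compose[OF _ l(1)]
      by (auto simp: alternating_bilinear_def o_def linear_0[OF l(1)])
    with rel have "l (sum_pairs \<beta> ys) = l (sum_pairs \<beta> xs)"
      unfolding bivector_rel_def comp[symmetric] by blast
    with l show False by (simp add: w_def linear_diff)
  qed
  then show ?thesis by (simp add: ext_bivector_def ys_def sum_pairs_def)
qed

lemma ext_bivector_linear:
  fixes \<beta> :: "'a::real_vector \<Rightarrow> 'a \<Rightarrow> 'w::real_vector"
  assumes "alternating_bilinear \<beta>"
  shows "linear (ext_bivector \<beta>)" and "ext_bivector \<beta> (wedge x y) = \<beta> x y"
proof -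
  have abs: "ext_bivector \<beta> (abs_bivector xs) = sum_pairs \<beta> xs" for xs
    using ext_bivector_abs[OF assms] by (simp add: sum_pairs_def)
  have ex: "\<exists>xs. X = abs_bivector xs" for X :: "'a bivector"
    by (metis Quotient3_abs_rep[OF Quotient3_bivector])
  show "linear (ext_bivector \<beta>)"
  proof (rule linearI)
    fix X Y :: "'a bivector" and c :: real
    obtain xs ys where XY: "X = abs_bivector xs" "Y = abs_bivector ys" using ex by blast
    show "ext_bivector \<beta> (X + Y) = ext_bivector \<beta> X + ext_bivector \<beta> Y"
      by (simp add: XY plus_bivector.abs_eq abs sum_pairs_append)
    show "ext_bivector \<beta> (c *\<^sub>R X) = c *\<^sub>R ext_bivector \<beta> X"
      by (simp add: XY scaleR_bivector.abs_eq abs sum_pairs_scale[OF assms])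
  qed
  show "ext_bivector \<beta> (wedge x y) = \<beta> x y"
    by (simp add: wedge.abs_eq abs) (simp add: sum_pairs_def)
qed


section \<open>3-Lie algebras and the cohomology of a morphism\<close>

definition alternating_trilinear ::
  "('a::real_vector \<Rightarrow> 'a \<Rightarrow> 'a \<Rightarrow> 'w::real_vector) \<Rightarrow> bool" where
  "alternating_trilinear \<pi> \<longleftrightarrow>
     (\<forall>y z. linear (\<lambda>x. \<pi> x y z)) \<and> (\<forall>x z. linear (\<lambda>y. \<pi> x y z)) \<and>
     (\<forall>x y. linear (\<lambda>z. \<pi> x y z)) \<and>
     (\<forall>x y. \<pi> x x y = 0 \<and> \<pi> x y x = 0 \<and> \<pi> y x x = 0)"

text \<open>Linear maps on the exterior cube are rendered as alternating trilinear maps.\<close>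

definition three_Lie_algebra :: "('a::real_vector \<Rightarrow> 'a \<Rightarrow> 'a \<Rightarrow> 'a) \<Rightarrow> bool" where
  "three_Lie_algebra \<pi> \<longleftrightarrow> alternating_trilinear \<pi> \<and>
     (\<forall>x1 x2 x3 x4 x5.
        \<pi> x1 x2 (\<pi> x3 x4 x5) =
          \<pi> (\<pi> x1 x2 x3) x4 x5 + \<pi> x3 (\<pi> x1 x2 x4) x5 + \<pi> x3 x4 (\<pi> x1 x2 x5))"

definition finite_dimensional :: "'a::real_vector set \<Rightarrow> bool" where
  "finite_dimensional V \<longleftrightarrow> (\<exists>B. finite B \<and> V = span B)"

text \<open>
  In finite dimension every linear map is bounded and all norms are equivalent, so for
  finite-dimensional \<open>'a\<close> and \<open>'b\<close> the type \<open>'a \<Rightarrow>\<^sub>L 'b\<close> is the space of all linear maps with its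
  usual topology and smooth structure.  (The type class \<open>euclidean_space\<close> would exclude dimension 0.)
\<close>

definition three_Lie_morphism ::
  "('a::real_normed_vector \<Rightarrow> 'a \<Rightarrow> 'a \<Rightarrow> 'a) \<Rightarrow> ('b::real_normed_vector \<Rightarrow> 'b \<Rightarrow> 'b \<Rightarrow> 'b) \<Rightarrow>
     ('a \<Rightarrow>\<^sub>L 'b) \<Rightarrow> bool" where
  "three_Lie_morphism \<pi> \<mu> f \<longleftrightarrow>
     (\<forall>x y z. blinfun_apply f (\<pi> x y z) =
        \<mu> (blinfun_apply f x) (blinfun_apply f y) (blinfun_apply f z))"

definition ad :: "('b::real_vector \<Rightarrow> 'b \<Rightarrow> 'b \<Rightarrow> 'b) \<Rightarrow> 'b bivector \<Rightarrow> 'b \<Rightarrow> 'b" where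
  "ad \<mu> \<U> z = ext_bivector (\<lambda>u v. \<mu> u v z) \<U>"

definition InnDer :: "('b::real_normed_vector \<Rightarrow> 'b \<Rightarrow> 'b \<Rightarrow> 'b) \<Rightarrow> ('b \<Rightarrow>\<^sub>L 'b) set" where
  "InnDer \<mu> = {D. \<exists>\<U>. blinfun_apply D = ad \<mu> \<U>}"

definition delta0 ::
  "('a::real_normed_vector \<Rightarrow> 'a \<Rightarrow> 'a \<Rightarrow> 'a) \<Rightarrow> ('b::real_normed_vector \<Rightarrow> 'b \<Rightarrow> 'b \<Rightarrow> 'b) \<Rightarrow>
     ('a \<Rightarrow>\<^sub>L 'b) \<Rightarrow> 'a bivector \<times> 'b bivector \<Rightarrow> 'a \<Rightarrow> 'b" where
  "delta0 \<pi> \<mu> f = (\<lambda>(\<X>, \<U>) z.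
     ext_bivector (\<lambda>u v. \<mu> u v (blinfun_apply f z)) \<U> -
     ext_bivector (\<lambda>x y. blinfun_apply f (\<pi> x y z)) \<X>)"

definition delta1 ::
  "('a::real_normed_vector \<Rightarrow> 'a \<Rightarrow> 'a \<Rightarrow> 'a) \<Rightarrow> ('b::real_normed_vector \<Rightarrow> 'b \<Rightarrow> 'b \<Rightarrow> 'b) \<Rightarrow>
     ('a \<Rightarrow>\<^sub>L 'b) \<Rightarrow> ('a \<Rightarrow>\<^sub>L 'b) \<Rightarrow> 'a \<Rightarrow> 'a \<Rightarrow> 'a \<Rightarrow> 'b" where
  "delta1 \<pi> \<mu> f \<theta> x y z =
     - blinfun_apply \<theta> (\<pi> x y z)
     + \<mu> (blinfun_apply f x) (blinfun_apply f y) (blinfun_apply \<theta> z)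
     + \<mu> (blinfun_apply \<theta> x) (blinfun_apply f y) (blinfun_apply f z)
     + \<mu> (blinfun_apply f x) (blinfun_apply \<theta> y) (blinfun_apply f z)"

definition Z1 ::
  "('a::real_normed_vector \<Rightarrow> 'a \<Rightarrow> 'a \<Rightarrow> 'a) \<Rightarrow> ('b::real_normed_vector \<Rightarrow> 'b \<Rightarrow> 'b \<Rightarrow> 'b) \<Rightarrow>
     ('a \<Rightarrow>\<^sub>L 'b) \<Rightarrow> ('a \<Rightarrow>\<^sub>L 'b) set" where
  "Z1 \<pi> \<mu> f = {\<theta>. \<forall>x y z. delta1 \<pi> \<mu> f \<theta> x y z = 0}"

definition B1 ::
  "('a::real_normed_vector \<Rightarrow> 'a \<Rightarrow> 'a \<Rightarrow> 'a) \<Rightarrow> ('b::real_normed_vector \<Rightarrow> 'b \<Rightarrow> 'b \<Rightarrow> 'b) \<Rightarrow>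
     ('a \<Rightarrow>\<^sub>L 'b) \<Rightarrow> ('a \<Rightarrow>\<^sub>L 'b) set" where
  "B1 \<pi> \<mu> f = {\<theta>. \<exists>c. blinfun_apply \<theta> = delta0 \<pi> \<mu> f c}"

text \<open>The quotient \<open>Z1 / B1\<close> as a set of cosets; its zero element is the coset \<open>B1\<close>.\<close>

definition H1 ::
  "('a::real_normed_vector \<Rightarrow> 'a \<Rightarrow> 'a \<Rightarrow> 'a) \<Rightarrow> ('b::real_normed_vector \<Rightarrow> 'b \<Rightarrow> 'b \<Rightarrow> 'b) \<Rightarrow>
     ('a \<Rightarrow>\<^sub>L 'b) \<Rightarrow> ('a \<Rightarrow>\<^sub>L 'b) set set" where
  "H1 \<pi> \<mu> f = (\<lambda>\<theta>. (+) \<theta> ` B1 \<pi> \<mu> f) ` Z1 \<pi> \<mu> f"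


section \<open>Smooth manifolds and Lie groups\<close>

text \<open>
  \<open>Ck_on\<close> is used for sets \<open>S\<close> that are relatively open in a finite-dimensional subspace of \<open>'e\<close>.
  There \<open>f' x\<close> is determined exactly on that subspace, and its directional derivatives
  \<open>\<lambda>x. f' x v\<close> being of class \<open>k\<close> is the usual recursive definition of class \<open>k + 1\<close>; for \<open>v\<close>
  outside the subspace the condition can be met by composing \<open>f' x\<close> with a projection.
\<close>

primrec Ck_on ::
  "nat \<Rightarrow> 'e::real_normed_vector set \<Rightarrow> ('e \<Rightarrow> 'f::real_normed_vector) \<Rightarrow> bool" where
  "Ck_on 0 S f \<longleftrightarrow> continuous_on S f"
| "Ck_on (Suc k) S f \<longleftrightarrow>
     (\<exists>f'. (\<forall>x\<in>S. (f has_derivative f' x) (at x within S)) \<and> (\<forall>v. Ck_on k S (\<lambda>x. f' x v)))"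

definition smooth_on ::
  "'e::real_normed_vector set \<Rightarrow> ('e \<Rightarrow> 'f::real_normed_vector) \<Rightarrow> bool" where
  "smooth_on S f \<longleftrightarrow> (\<forall>k. Ck_on k S f)"

text \<open>
  The charts of a manifold take values in a finite-dimensional subspace \<open>model\<close> of \<open>'e\<close>, so that
  the dimension is not tied to a type and may be 0.
\<close>

record ('p, 'e) manifold =
  mtop :: "'p topology"
  model :: "'e set"
  atlas :: "('p set \<times> ('p \<Rightarrow> 'e)) set"

definition chart :: "('p, 'e::real_normed_vector) manifold \<Rightarrow> 'p set \<Rightarrow> ('p \<Rightarrow> 'e) \<Rightarrow> bool" where
  "chart M U \<phi> \<longleftrightarrow>
     openin (mtop M) U \<and> openin (top_of_set (model M)) (\<phi> ` U) \<and>
     homeomorphic_map (subtopology (mtop M) U) (top_of_set (\<phi> ` U)) \<phi>"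

definition smooth_manifold :: "('p, 'e::real_normed_vector) manifold \<Rightarrow> bool" where
  "smooth_manifold M \<longleftrightarrow>
     Hausdorff_space (mtop M) \<and> second_countable (mtop M) \<and>
     finite_dimensional (model M) \<and>
     (\<forall>(U, \<phi>)\<in>atlas M. chart M U \<phi>) \<and>
     (\<Union>(U, \<phi>)\<in>atlas M. U) = topspace (mtop M) \<and>
     (\<forall>(U, \<phi>)\<in>atlas M. \<forall>(V, \<psi>)\<in>atlas M. smooth_on (\<phi> ` (U \<inter> V)) (\<psi> \<circ> inv_into U \<phi>))"

definition smooth_map ::
  "('p, 'e::real_normed_vector) manifold \<Rightarrow> ('q, 'f::real_normed_vector) manifold \<Rightarrow>
     ('p \<Rightarrow> 'q) \<Rightarrow> bool" where
  "smooth_map M N F \<longleftrightarrow>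
     continuous_map (mtop M) (mtop N) F \<and>
     (\<forall>(U, \<phi>)\<in>atlas M. \<forall>(V, \<psi>)\<in>atlas N.
        smooth_on (\<phi> ` {x \<in> U. F x \<in> V}) (\<psi> \<circ> F \<circ> inv_into U \<phi>))"

definition prod_manifold ::
  "('p, 'e::real_normed_vector) manifold \<Rightarrow> ('q, 'f::real_normed_vector) manifold \<Rightarrow>
     ('p \<times> 'q, 'e \<times> 'f) manifold" where
  "prod_manifold M N =
     \<lparr>mtop = prod_topology (mtop M) (mtop N), model = model M \<times> model N,
      atlas = {(U \<times> V, map_prod \<phi> \<psi>) |U \<phi> V \<psi>. (U, \<phi>) \<in> atlas M \<and> (V, \<psi>) \<in> atlas N}\<rparr>"

definition open_submanifold :: "'e::real_normed_vector set \<Rightarrow> ('e, 'e) manifold" where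
  "open_submanifold S = \<lparr>mtop = top_of_set S, model = UNIV, atlas = {(S, \<lambda>x. x)}\<rparr>"

definition Lie_group :: "'g monoid \<Rightarrow> ('g, 'e::real_normed_vector) manifold \<Rightarrow> bool" where
  "Lie_group G M \<longleftrightarrow>
     group G \<and> smooth_manifold M \<and> topspace (mtop M) = carrier G \<and>
     smooth_map (prod_manifold M M) M (\<lambda>(x, y). x \<otimes>\<^bsub>G\<^esub> y) \<and>
     smooth_map M M (\<lambda>x. inv\<^bsub>G\<^esub> x)"

definition simply_connected_space :: "'p topology \<Rightarrow> bool" where
  "simply_connected_space X \<longleftrightarrow>
     path_connected_space X \<and>
     (\<forall>p. pathin X p \<and> p 0 = p 1 \<longrightarrow>
        homotopic_with (\<lambda>r. r 0 = p 0 \<and> r 1 = p 0) (top_of_set {0..1}) X p (\<lambda>_. p 0))"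

text \<open>
  The bracket on the tangent space at the identity, read in a chart \<open>(U, \<phi>)\<close> around it: if \<open>m\<close> is
  the multiplication in the chart and \<open>e\<close> the identity, then
  \<open>[v, w] = D\<^sub>1 D\<^sub>2 m(e, e)(v, w) - D\<^sub>1 D\<^sub>2 m(e, e)(w, v)\<close>.
  This is the commutator bracket for matrix groups.
\<close>

definition Lie_bracket ::
  "'g monoid \<Rightarrow> ('g, 'e::real_normed_vector) manifold \<Rightarrow> 'g set \<Rightarrow> ('g \<Rightarrow> 'e) \<Rightarrow>
     'e \<Rightarrow> 'e \<Rightarrow> 'e" where
  "Lie_bracket G M U \<phi> v w =
     (let e = \<phi> \<one>\<^bsub>G\<^esub>;
          m = (\<lambda>x y. \<phi> (inv_into U \<phi> x \<otimes>\<^bsub>G\<^esub> inv_into U \<phi> y));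
          D2 = (\<lambda>b x. frechet_derivative (m x) (at e within model M) b);
          D12 = (\<lambda>a b. frechet_derivative (D2 b) (at e within model M) a)
      in D12 v w - D12 w v)"

definition general_linear_group :: "('b::real_normed_vector \<Rightarrow>\<^sub>L 'b) monoid" where
  "general_linear_group =
     \<lparr>carrier = {A. \<exists>B. A o\<^sub>L B = id_blinfun \<and> B o\<^sub>L A = id_blinfun},
      mult = (o\<^sub>L), one = id_blinfun\<rparr>"

text \<open>
  \<open>\<rho>\<close> is a morphism of Lie groups into the general linear group whose differential at the
  identity, read in a chart, is an isomorphism \<open>\<lambda>\<close> of Lie algebras from the tangent space onto \<open>L\<close>.
  Thus \<open>\<lambda>\<close> identifies the Lie algebra of the group with \<open>L\<close>, and \<open>\<rho>\<close> integrates the inclusion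
  of \<open>L\<close>.
\<close>

definition integrates_inclusion ::
  "'g monoid \<Rightarrow> ('g, 'e::real_normed_vector) manifold \<Rightarrow> ('g \<Rightarrow> ('b::real_normed_vector \<Rightarrow>\<^sub>L 'b)) \<Rightarrow>
     ('b \<Rightarrow>\<^sub>L 'b) set \<Rightarrow> bool" where
  "integrates_inclusion G M \<rho> L \<longleftrightarrow>
     \<rho> \<in> hom G general_linear_group \<and>
     smooth_map M (open_submanifold (carrier general_linear_group)) \<rho> \<and>
     (\<exists>(U, \<phi>)\<in>atlas M. \<one>\<^bsub>G\<^esub> \<in> U \<and>
        (\<exists>l. ((\<rho> \<circ> inv_into U \<phi>) has_derivative l) (at (\<phi> \<one>\<^bsub>G\<^esub>) within model M) \<and>
           bij_betw l (model M) L \<and>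
           (\<forall>v\<in>model M. \<forall>w\<in>model M.
              l (Lie_bracket G M U \<phi> v w) = (l v o\<^sub>L l w) - (l w o\<^sub>L l v))))"

text \<open>
  \<open>(G, M, \<rho>)\<close> is the inner automorphism group together with its linear representation.  These
  conditions determine \<open>(G, M, \<rho>)\<close> up to a unique isomorphism.
\<close>

definition is_InnAut ::
  "('b::real_normed_vector \<Rightarrow> 'b \<Rightarrow> 'b \<Rightarrow> 'b) \<Rightarrow> 'g monoid \<Rightarrow> ('g, 'e::real_normed_vector) manifold \<Rightarrow>
     ('g \<Rightarrow> ('b \<Rightarrow>\<^sub>L 'b)) \<Rightarrow> bool" where
  "is_InnAut \<mu> G M \<rho> \<longleftrightarrow>
     Lie_group G M \<and> connected_space (mtop M) \<and> simply_connected_space (mtop M) \<and>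
     integrates_inclusion G M \<rho> (InnDer \<mu>)"

end

theory Submission
  imports Defs
begin

text \<open>
  The orbit map \<open>g \<mapsto> \<rho> g \<circ> f\<close> has differential \<open>v \<mapsto> l v \<circ> f\<close> at the identity, and its image contains
  \<open>Z1\<close> because \<open>H1 = 0\<close>.  Let \<open>\<sigma>\<close> be a linear right inverse of this differential, defined on all of
  \<open>Hom(\<gg>, \<hh>)\<close>, and let \<open>\<tau> \<theta> = \<theta> - l (\<sigma> \<theta>) \<circ> f\<close> be the complementary projection.  In a chart \<open>\<phi>\<close> at the
  identity \<open>e\<close>, the map \<open>\<Psi> \<theta> = \<rho> (\<phi>\<^sup>-\<^sup>1 (\<phi> e + \<sigma> \<theta>)) \<circ> (f + \<tau> \<theta>)\<close> has derivative the identity at \<open>0\<close>, so it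
  has a smooth local inverse \<open>H\<close>, and \<open>p f' = \<phi>\<^sup>-\<^sup>1 (\<phi> e + \<sigma> (H f'))\<close> works: since \<open>\<rho> g\<close> is an automorphism, if
  \<open>f' = \<Psi> \<theta>\<close> is a morphism then so is \<open>f + \<tau> \<theta>\<close>, and \<open>delta1\<close> is injective on the range of \<open>\<tau>\<close>, which
  forces \<open>\<tau> \<theta> = 0\<close>.
\<close>

section \<open>Finite-dimensional normed spaces\<close>

text \<open>\<open>is_InnAut\<close> does not state that \<open>\<rho> g\<close> preserves
  \<open>\<mu>\<close>; it gives a smooth homomorphism with a prescribed differential at the
  identity. Preservation is therefore derived near the identity, without exponentials: translation
  in the group carries the first-order information at the identity to every point of a convex chart
  neighbourhood, where the pulled-back bracket is then constant. The set of morphisms need not be a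
  manifold and the orbit map may have a kernel, so neither is inverted directly. Adding the
  \<open>\<tau>\<close> component gives a map of \<open>Hom\<close> to itself with invertible
  derivative, and the morphism equation is used only afterwards, to kill that component.
  \<open>delta1\<close> is injective on the range of \<open>\<tau>\<close> because
  \<open>\<tau>\<close> vanishes on \<open>Z1\<close> and is idempotent: a cocycle
  \<open>\<tau> \<theta>\<close> equals \<open>\<tau> (\<tau> \<theta>) = 0\<close>. All spaces are
  normed spaces with a finite spanning set, possibly zero, and \<open>Ck_on\<close> speaks only of
  derivatives in fixed directions. The recurring device is to expand a moving vector in a basis with
  bounded coordinate functionals.\<close>

lemma complete_span_if_coordinates_bounded:
  fixes B :: "'v::real_normed_vector set"
  assumes "finite B" "K > 0"
    and K: "\<And>c b. b \<in> B \<Longrightarrow> \<bar>c b\<bar> \<le> K * norm (\<Sum>b\<in>B. c b *\<^sub>R b)"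
  shows "complete (span B)"
proof (rule completeI)
  fix s :: "nat \<Rightarrow> 'v"
  assume "\<forall>n. s n \<in> span B" and s: "Cauchy s"
  then have "\<forall>n. \<exists>c. s n = (\<Sum>b\<in>B. c b *\<^sub>R b)"
    using span_finite[OF \<open>finite B\<close>] by auto
  then obtain c where c: "\<And>n. s n = (\<Sum>b\<in>B. c n b *\<^sub>R b)" by metis
  have "Cauchy (\<lambda>n. c n b)" if "b \<in> B" for b
  proof (rule metric_CauchyI)
    fix e :: real
    assume "e > 0"
    then obtain N where N: "\<And>m n. m \<ge> N \<Longrightarrow> n \<ge> N \<Longrightarrow> dist (s m) (s n) < e / K"
      using metric_CauchyD[OF s, of "e / K"] \<open>K > 0\<close> by auto
    have "dist (c m b) (c n b) < e" if "m \<ge> N" "n \<ge> N" for m n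
    proof -
      have "\<bar>c m b - c n b\<bar> \<le> K * norm (s m - s n)"
        using K[OF \<open>b \<in> B\<close>, of "\<lambda>b. c m b - c n b"]
        by (simp add: c scaleR_diff_left sum_subtractf)
      also have "\<dots> < e"
        using N[OF that] \<open>K > 0\<close> by (simp add: dist_norm field_simps)
      finally show ?thesis by (simp add: dist_real_def)
    qed
    then show "\<exists>N. \<forall>m\<ge>N. \<forall>n\<ge>N. dist (c m b) (c n b) < e" by blast
  qed
  then have "\<forall>b. \<exists>L. b \<in> B \<longrightarrow> (\<lambda>n. c n b) \<longlonglongrightarrow> L"
    using Cauchy_convergent convergent_def by blast
  then obtain L where L: "\<And>b. b \<in> B \<Longrightarrow> (\<lambda>n. c n b) \<longlonglongrightarrow> L b" by metis
  have "s \<longlonglongrightarrow> (\<Sum>b\<in>B. L b *\<^sub>R b)"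
    unfolding c by (intro tendsto_sum tendsto_scaleR L tendsto_const)
  moreover have "(\<Sum>b\<in>B. L b *\<^sub>R b) \<in> span B"
    by (intro span_sum span_scale span_base)
  ultimately show "\<exists>l\<in>span B. s \<longlonglongrightarrow> l" by blast
qed

text \<open>The bound and completeness advance together: the bound for \<open>B\<close> makes
  \<open>span B\<close> complete, hence closed, so the next vector \<open>a\<close> has positive
  distance \<open>d\<close> from it, and \<open>d\<close> bounds the new coefficient.\<close>

lemma independent_coordinates_bounded:
  fixes B :: "'v::real_normed_vector set"
  assumes "finite B" "independent B"
  shows "\<exists>K>0. \<forall>c. \<forall>b\<in>B. \<bar>c b\<bar> \<le> K * norm (\<Sum>b\<in>B. c b *\<^sub>R b)"
  using assms
proof (induction B rule: finite_induct)
  case empty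
  then show ?case by (auto intro: exI[of _ 1])
next
  case (insert a B)
  then have a: "a \<notin> span B" and "independent B"
    by (auto simp: independent_insert)
  with insert.IH obtain K where "K > 0"
    and K: "\<And>c b. b \<in> B \<Longrightarrow> \<bar>c b\<bar> \<le> K * norm (\<Sum>b\<in>B. c b *\<^sub>R b)" by blast
  have "closed (span B)"
    using complete_span_if_coordinates_bounded[OF \<open>finite B\<close> \<open>K > 0\<close> K]
    by (rule complete_imp_closed)
  with a obtain d where "d > 0" and d: "\<And>v. v \<in> span B \<Longrightarrow> d \<le> dist v a"
    unfolding closed_def open_dist by (metis ComplD ComplI not_less)
  \<comment> \<open>\<open>1 / d\<close> pays for the coefficient of \<open>a\<close>. The other
    summand pays for the remaining ones, since removing the \<open>a\<close> component multiplies
    the norm by at most \<open>1 + norm a / d\<close>.\<close>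
  define K' where "K' = 1 / d + K * (1 + norm a / d)"
  have "K' > 0" using \<open>K > 0\<close> \<open>d > 0\<close> by (simp add: K'_def add_pos_nonneg)
  moreover have "\<bar>c b\<bar> \<le> K' * norm (\<Sum>b\<in>insert a B. c b *\<^sub>R b)" if "b \<in> insert a B" for c b
  proof -
    define u where "u = (\<Sum>b\<in>B. c b *\<^sub>R b)"
    define v where "v = (\<Sum>b\<in>insert a B. c b *\<^sub>R b)"
    have v: "v = c a *\<^sub>R a + u" using insert.hyps by (simp add: v_def u_def)
    have "u \<in> span B" unfolding u_def by (intro span_sum span_scale span_base)
    have ca: "\<bar>c a\<bar> \<le> norm v / d"
    proof (cases "c a = 0")
      case False
      have "(- (1 / c a)) *\<^sub>R u \<in> span B" using \<open>u \<in> span B\<close> by (rule span_scale)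
      then have "d \<le> norm (- ((1 / c a) *\<^sub>R u) - a)" using d by (auto simp: dist_norm)
      also have "- ((1 / c a) *\<^sub>R u) - a = (- (1 / c a)) *\<^sub>R v"
        using False by (simp add: v algebra_simps)
      finally show ?thesis using False \<open>d > 0\<close> by (simp add: field_simps)
    qed (use \<open>d > 0\<close> in simp)
    have "u = v - c a *\<^sub>R a" by (simp add: v)
    then have "norm u \<le> norm v + \<bar>c a\<bar> * norm a"
      by (metis norm_scaleR norm_triangle_ineq4)
    also have "\<dots> \<le> norm v + norm v / d * norm a"
      using mult_right_mono[OF ca norm_ge_zero[of a]] by simp
    finally have u: "norm u \<le> norm v * (1 + norm a / d)" by (simp add: field_simps)
    have "\<bar>c b\<bar> \<le> norm v / d + K * (norm v * (1 + norm a / d))"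
    proof (cases "b = a")
      case True
      then show ?thesis using ca \<open>K > 0\<close> \<open>d > 0\<close>
        by (smt (verit) divide_nonneg_nonneg mult_nonneg_nonneg norm_ge_zero)
    next
      case False
      then have "\<bar>c b\<bar> \<le> K * norm u" using that K by (auto simp: u_def)
      also have "\<dots> \<le> K * (norm v * (1 + norm a / d))" using u \<open>K > 0\<close> by simp
      finally show ?thesis using \<open>d > 0\<close> by (smt (verit) divide_nonneg_nonneg norm_ge_zero)
    qed
    also have "\<dots> = K' * norm v" by (simp add: K'_def algebra_simps)
    finally show ?thesis unfolding v_def .
  qed
  ultimately show ?case by blast
qed

lemma finite_dimensional_basis:
  assumes "finite_dimensional V"
  obtains B where "finite B" "independent B" "span B = V"
proof -
  obtain C where C: "finite C" "V = span C"
    using assms by (auto simp: finite_dimensional_def)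
  obtain B where B: "B \<subseteq> C" "independent B" "C \<subseteq> span B"
    using maximal_independent_subset[of C] by blast
  have "span B = V"
    using B C span_mono[OF B(1)] span_minimal[OF B(3)] by auto
  with B C that show thesis using finite_subset by blast
qed

lemma finite_dimensional_subspace: "finite_dimensional V \<Longrightarrow> subspace V"
  by (auto simp: finite_dimensional_def)

text \<open>Boundedness holds for every index \<open>b\<close>: off the basis the functional is
  zero. Basis expansions can thus be differentiated term by term without side conditions on the
  index.\<close>

lemma finite_dimensional_coordinates:
  assumes "finite_dimensional (UNIV :: 'v::real_normed_vector set)"
  obtains B :: "'v::real_normed_vector set" and \<kappa> where "finite B" "\<And>b. bounded_linear (\<kappa> b)"
    "\<And>v. (\<Sum>b\<in>B. \<kappa> b v *\<^sub>R b) = v"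
proof -
  obtain B :: "'v set" where B: "finite B" "independent B" "span B = UNIV"
    using finite_dimensional_basis[OF assms] by blast
  define \<kappa> where "\<kappa> b v = representation B v b" for b v
  have sum: "(\<Sum>b\<in>B. \<kappa> b v *\<^sub>R b) = v" for v
    unfolding \<kappa>_def using sum_representation_eq[of B v B] B by auto
  obtain K where K: "\<And>c b. b \<in> B \<Longrightarrow> \<bar>c b\<bar> \<le> K * norm (\<Sum>b\<in>B. c b *\<^sub>R b)"
    using independent_coordinates_bounded[OF B(1,2)] by blast
  have "bounded_linear (\<kappa> b)" for b
  proof (cases "b \<in> B")
    case True
    show ?thesis
    proof (rule bounded_linear_intro)
      show "\<kappa> b (x + y) = \<kappa> b x + \<kappa> b y" "\<kappa> b (r *\<^sub>R x) = r *\<^sub>R \<kappa> b x" for x y r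
        using B by (auto simp: \<kappa>_def representation_add representation_scale)
      show "norm (\<kappa> b x) \<le> norm x * K" for x
        using K[OF True, of "\<lambda>b. \<kappa> b x"] by (simp add: sum mult.commute)
    qed
  next
    case False
    then have "\<kappa> b = (\<lambda>_. 0)"
      unfolding \<kappa>_def using representation_ne_zero[of B _ b] by blast
    then show ?thesis by simp
  qed
  with B(1) sum that show thesis by blast
qed

lemma finite_dimensional_bounded_linear:
  fixes T :: "'v::real_normed_vector \<Rightarrow> 'w::real_normed_vector"
  assumes "finite_dimensional (UNIV :: 'v set)" "linear T"
  shows "bounded_linear T"
proof -
  obtain B :: "'v set" and \<kappa> where B: "finite B" "\<And>b. bounded_linear (\<kappa> b)"
    "\<And>v. (\<Sum>b\<in>B. \<kappa> b v *\<^sub>R b) = v"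
    using finite_dimensional_coordinates[OF assms(1)] by blast
  have "T v = (\<Sum>b\<in>B. \<kappa> b v *\<^sub>R T b)" for v
    by (subst B(3)[of v, symmetric])
      (simp add: linear_sum[OF assms(2)] linear_cmul[OF assms(2)])
  then have "T = (\<lambda>v. \<Sum>b\<in>B. \<kappa> b v *\<^sub>R T b)" by blast
  moreover have "bounded_linear (\<lambda>v. \<Sum>b\<in>B. \<kappa> b v *\<^sub>R T b)"
    by (intro bounded_linear_sum bounded_linear_scaleR_const B)
  ultimately show ?thesis by metis
qed

lemma finite_dimensional_complete:
  assumes "finite_dimensional (V :: 'v::real_normed_vector set)"
  shows "complete V"
proof -
  obtain B :: "'v set" where B: "finite B" "independent B" "span B = V"
    using finite_dimensional_basis[OF assms] by blast
  obtain K where "K > 0" "\<And>c b. b \<in> B \<Longrightarrow> \<bar>c b\<bar> \<le> K * norm (\<Sum>b\<in>B. c b *\<^sub>R b)"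
    using independent_coordinates_bounded[OF B(1,2)] by blast
  from complete_span_if_coordinates_bounded[OF B(1) this] B(3) show ?thesis by simp
qed

text \<open>Instead of compactness of the unit sphere: injectivity on \<open>V\<close> sends a basis
  to an independent set, whose coordinate bound recovers the coefficients of \<open>v\<close> from
  \<open>T v\<close>.\<close>

lemma finite_dimensional_bounded_below:
  fixes T :: "'v::real_normed_vector \<Rightarrow> 'w::real_normed_vector"
  assumes "finite_dimensional V" "linear T" "\<And>v. v \<in> V \<Longrightarrow> T v = 0 \<Longrightarrow> v = 0"
  obtains a where "a > 0" "\<And>v. v \<in> V \<Longrightarrow> a * norm v \<le> norm (T v)"
proof -
  obtain B :: "'v set" where B: "finite B" "independent B" "span B = V"
    using finite_dimensional_basis[OF assms(1)] by blast
  have inj: "inj_on T (span B)"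
    using assms(3) B(3) linear_injective_on_subspace_0[OF assms(2), of "span B"] by auto
  then have injB: "inj_on T B" by (rule inj_on_subset) (rule span_superset)
  obtain K where "K > 0"
    and K: "\<And>c b. b \<in> T ` B \<Longrightarrow> \<bar>c b\<bar> \<le> K * norm (\<Sum>b\<in>T ` B. c b *\<^sub>R b)"
    using independent_coordinates_bounded[of "T ` B"]
      linear_independent_injective_image[OF assms(2) B(2) inj] B(1) by blast
  \<comment> \<open>The summand 1 keeps \<open>N\<close> positive when the basis is empty.\<close>
  define N where "N = 1 + K * (\<Sum>b\<in>B. norm b)"
  have "N > 0" using \<open>K > 0\<close> by (simp add: N_def add_pos_nonneg sum_nonneg)
  have "1 / N * norm v \<le> norm (T v)" if v: "v \<in> V" for v
  proof -
    obtain c where c: "v = (\<Sum>b\<in>B. c b *\<^sub>R b)"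
      using v span_finite[OF B(1)] B(3) by auto
    have Tv: "T v = (\<Sum>b\<in>T ` B. c (inv_into B T b) *\<^sub>R b)"
      by (simp add: c linear_sum[OF assms(2)] linear_cmul[OF assms(2)] sum.reindex[OF injB] injB)
    have "norm v \<le> (\<Sum>b\<in>B. \<bar>c b\<bar> * norm b)"
      unfolding c by (rule order_trans[OF norm_sum]) simp
    also have "\<dots> \<le> (\<Sum>b\<in>B. K * norm (T v) * norm b)"
    proof (intro sum_mono mult_right_mono)
      fix b assume "b \<in> B"
      then show "\<bar>c b\<bar> \<le> K * norm (T v)"
        using K[of "T b" "\<lambda>b. c (inv_into B T b)"] injB by (simp add: Tv)
    qed simp
    also have "\<dots> = K * (\<Sum>b\<in>B. norm b) * norm (T v)"
      by (simp add: sum_distrib_left sum_distrib_right algebra_simps)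
    also have "\<dots> \<le> N * norm (T v)"
      by (simp add: N_def distrib_right)
    finally show ?thesis using \<open>N > 0\<close> by (simp add: field_simps)
  qed
  with \<open>N > 0\<close> that[of "1 / N"] show thesis by simp
qed

lemma finite_dimensional_blinfun:
  assumes "finite_dimensional (UNIV :: 'v::real_normed_vector set)"
    and "finite_dimensional (UNIV :: 'w::real_normed_vector set)"
  shows "finite_dimensional (UNIV :: ('v \<Rightarrow>\<^sub>L 'w) set)"
proof -
  obtain A :: "'v set" and \<kappa> where A: "finite A" "\<And>b. bounded_linear (\<kappa> b)"
    "\<And>v. (\<Sum>b\<in>A. \<kappa> b v *\<^sub>R b) = v"
    using finite_dimensional_coordinates[OF assms(1)] by blast
  obtain B :: "'w set" and \<nu> where B: "finite B" "\<And>b. bounded_linear (\<nu> b)"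
    "\<And>v. (\<Sum>b\<in>B. \<nu> b v *\<^sub>R b) = v"
    using finite_dimensional_coordinates[OF assms(2)] by blast
  define E :: "'v \<times> 'w \<Rightarrow> 'v \<Rightarrow>\<^sub>L 'w" where "E = (\<lambda>(a, b). Blinfun (\<lambda>v. \<kappa> a v *\<^sub>R b))"
  have E: "blinfun_apply (E (a, b)) v = \<kappa> a v *\<^sub>R b" for a b v
    unfolding E_def by (simp add: bounded_linear_Blinfun_apply bounded_linear_scaleR_const A)
  have "T \<in> span (E ` (A \<times> B))" for T :: "'v \<Rightarrow>\<^sub>L 'w"
  proof -
    have "T = (\<Sum>a\<in>A. \<Sum>b\<in>B. \<nu> b (blinfun_apply T a) *\<^sub>R E (a, b))"
    proof (rule blinfun_eqI)
      fix v
      have "blinfun_apply T v = (\<Sum>a\<in>A. \<kappa> a v *\<^sub>R T a)"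
        by (subst A(3)[of v, symmetric]) (simp add: blinfun.sum_right blinfun.scaleR_right)
      also have "\<dots> = (\<Sum>a\<in>A. \<kappa> a v *\<^sub>R (\<Sum>b\<in>B. \<nu> b (T a) *\<^sub>R b))"
        by (simp add: B(3))
      also have "\<dots> = blinfun_apply (\<Sum>a\<in>A. \<Sum>b\<in>B. \<nu> b (T a) *\<^sub>R E (a, b)) v"
        by (simp add: blinfun.sum_left blinfun.scaleR_left E scaleR_sum_right mult.commute)
      finally show "blinfun_apply T v = blinfun_apply (\<Sum>a\<in>A. \<Sum>b\<in>B. \<nu> b (T a) *\<^sub>R E (a, b)) v" .
    qed
    also have "\<dots> \<in> span (E ` (A \<times> B))"
      by (intro span_sum span_scale span_base) auto
    finally show ?thesis .
  qed
  with A(1) B(1) show ?thesis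
    unfolding finite_dimensional_def by (intro exI[of _ "E ` (A \<times> B)"]) auto
qed

section \<open>Maps of class \<open>C\<^sup>k\<close>\<close>

lemma Ck_on_Suc_imp: "Ck_on (Suc k) S f \<Longrightarrow> Ck_on k S f"
proof (induction k arbitrary: f)
  case 0
  then show ?case
    by (auto simp: continuous_on_eq_continuous_within dest: has_derivative_continuous)
next
  case (Suc k)
  then obtain f' where "\<forall>x\<in>S. (f has_derivative f' x) (at x within S)"
    "\<And>v. Ck_on (Suc k) S (\<lambda>x. f' x v)" by (auto simp only: Ck_on.simps(2)[of "Suc k"])
  with Suc.IH show ?case unfolding Ck_on.simps(2) by blast
qed

lemma Ck_on_imp_continuous_on: "Ck_on k S f \<Longrightarrow> continuous_on S f"
proof (induction k)
  case (Suc k)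
  then show ?case using Ck_on_Suc_imp by blast
qed simp

lemma Ck_on_cong:
  assumes "Ck_on k S f" "\<And>x. x \<in> S \<Longrightarrow> g x = f x"
  shows "Ck_on k S g"
proof (cases k)
  case 0
  then show ?thesis using assms continuous_on_cong[of S S g f] by simp
next
  case (Suc j)
  then show ?thesis
    using assms has_derivative_transform[of _ S g f] unfolding Suc Ck_on.simps by metis
qed

lemma Ck_on_subset: "Ck_on k S f \<Longrightarrow> T \<subseteq> S \<Longrightarrow> Ck_on k T f"
proof (induction k arbitrary: f)
  case 0
  then show ?case by (auto intro: continuous_on_subset)
next
  case (Suc k)
  then obtain f' where "\<forall>x\<in>S. (f has_derivative f' x) (at x within S)"
    "\<forall>v. Ck_on k S (\<lambda>x. f' x v)" by auto
  with Suc show ?case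
    unfolding Ck_on.simps by (intro exI[of _ f']) (auto intro: has_derivative_subset)
qed

lemma Ck_on_const: "Ck_on k S (\<lambda>x. c)"
proof (induction k arbitrary: c)
  case (Suc k)
  then show ?case unfolding Ck_on.simps by (intro exI[of _ "\<lambda>_ _. 0"]) simp
qed simp

lemma Ck_on_bounded_linear_apply:
  assumes "bounded_linear L" "Ck_on k S f"
  shows "Ck_on k S (\<lambda>x. L (f x))"
  using assms(2)
proof (induction k arbitrary: f)
  case 0
  then show ?case using bounded_linear.continuous_on[OF assms(1)] by simp
next
  case (Suc k)
  then obtain f' where "\<forall>x\<in>S. (f has_derivative f' x) (at x within S)"
    "\<forall>v. Ck_on k S (\<lambda>x. f' x v)" by auto
  with Suc.IH show ?case
    unfolding Ck_on.simps
    by (intro exI[of _ "\<lambda>x v. L (f' x v)"]) (auto intro: bounded_linear.has_derivative[OF assms(1)])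
qed

lemma Ck_on_ident: "Ck_on k S (\<lambda>x. x)"
proof (cases k)
  case (Suc j)
  then show ?thesis unfolding Suc Ck_on.simps
    by (intro exI[of _ "\<lambda>_ v. v"]) (simp add: Ck_on_const)
qed simp

lemma Ck_on_linear: "bounded_linear L \<Longrightarrow> Ck_on k S L"
  using Ck_on_bounded_linear_apply[OF _ Ck_on_ident] .

lemma Ck_on_add:
  assumes "Ck_on k S f" "Ck_on k S g"
  shows "Ck_on k S (\<lambda>x. f x + g x)"
  using assms
proof (induction k arbitrary: f g)
  case 0
  then show ?case by (simp add: continuous_on_add)
next
  case (Suc k)
  then obtain f' g' where "\<forall>x\<in>S. (f has_derivative f' x) (at x within S)"
    "\<forall>v. Ck_on k S (\<lambda>x. f' x v)" "\<forall>x\<in>S. (g has_derivative g' x) (at x within S)"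
    "\<forall>v. Ck_on k S (\<lambda>x. g' x v)" by auto
  with Suc.IH show ?case
    unfolding Ck_on.simps
    by (intro exI[of _ "\<lambda>x v. f' x v + g' x v"]) (auto intro: has_derivative_add)
qed

lemma Ck_on_sum: "(\<And>i. i \<in> I \<Longrightarrow> Ck_on k S (f i)) \<Longrightarrow> Ck_on k S (\<lambda>x. \<Sum>i\<in>I. f i x)"
  by (induction I rule: infinite_finite_induct) (auto intro: Ck_on_add Ck_on_const)

lemma Ck_on_bilinear:
  assumes b: "bounded_bilinear b" and "Ck_on k S f" "Ck_on k S g"
  shows "Ck_on k S (\<lambda>x. b (f x) (g x))"
  using assms(2,3)
proof (induction k arbitrary: f g)
  case 0
  then show ?case by (simp add: bounded_bilinear.continuous_on[OF b])
next
  case (Suc k)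
  then obtain f' g' where d: "\<forall>x\<in>S. (f has_derivative f' x) (at x within S)"
    "\<forall>v. Ck_on k S (\<lambda>x. f' x v)" "\<forall>x\<in>S. (g has_derivative g' x) (at x within S)"
    "\<forall>v. Ck_on k S (\<lambda>x. g' x v)" by auto
  show ?case
    unfolding Ck_on.simps
  proof (intro exI[of _ "\<lambda>x v. b (f x) (g' x v) + b (f' x v) (g x)"] conjI ballI allI)
    show "((\<lambda>x. b (f x) (g x)) has_derivative (\<lambda>v. b (f x) (g' x v) + b (f' x v) (g x)))
      (at x within S)" if "x \<in> S" for x
      using d that by (auto intro: bounded_bilinear.FDERIV[OF b])
    show "Ck_on k S (\<lambda>x. b (f x) (g' x v) + b (f' x v) (g x))" for v
      using d(2,4) Suc.prems[THEN Ck_on_Suc_imp] by (intro Ck_on_add Suc.IH) blast+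
  qed
qed

lemmas Ck_on_scaleR = Ck_on_bilinear[OF bounded_bilinear_scaleR]

text \<open>Kept apart from \<open>Ck_on_compose\<close> because here the middle space may be
  infinite-dimensional as a type, as with the type that contains the model space of a manifold. The
  inner derivative is the constant \<open>L\<close>, so the direction \<open>L v\<close> stays fixed
  and no basis is required.\<close>

lemma Ck_on_affine:
  assumes "bounded_linear L" "Ck_on k T g" "\<And>x. x \<in> S \<Longrightarrow> a + L x \<in> T"
  shows "Ck_on k S (\<lambda>x. g (a + L x))"
  using assms(2)
proof (induction k arbitrary: g)
  case 0
  have "continuous_on S (\<lambda>x. a + L x)"
    by (intro continuous_intros bounded_linear.continuous_on[OF assms(1)])
  with 0 show ?case using continuous_on_compose2[of T g S "\<lambda>x. a + L x"] assms(3) by auto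
next
  case (Suc k)
  then obtain g' where g: "\<forall>x\<in>T. (g has_derivative g' x) (at x within T)"
    "\<forall>v. Ck_on k T (\<lambda>x. g' x v)" by auto
  have "((\<lambda>x. g (a + L x)) has_derivative (\<lambda>v. g' (a + L x) (L v))) (at x within S)" if "x \<in> S" for x
  proof (rule has_derivative_in_compose[where f = "\<lambda>x. a + L x"])
    show "((\<lambda>x. a + L x) has_derivative L) (at x within S)"
      by (auto intro!: derivative_eq_intros bounded_linear.has_derivative[OF assms(1)])
    show "(g has_derivative g' (a + L x)) (at (a + L x) within (\<lambda>x. a + L x) ` S)"
      using g assms(3) that by (auto intro: has_derivative_subset)
  qed
  moreover have "Ck_on k S (\<lambda>x. g' (a + L x) (L v))" for v
    using Suc.IH[of "\<lambda>y. g' y (L v)"] g(2) by blast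
  ultimately show ?case
    unfolding Ck_on.simps by (intro exI[of _ "\<lambda>x v. g' (a + L x) (L v)"]) blast
qed

text \<open>The chain rule produces \<open>g' (f x) (f' x v)\<close>, whose direction moves with
  \<open>x\<close>, while \<open>Ck_on\<close> controls fixed directions only. Expanding
  \<open>f' x v\<close> in a basis reduces this to fixed directions with coefficients of class
  \<open>k\<close>.\<close>

lemma Ck_on_compose:
  fixes f :: "'u::real_normed_vector \<Rightarrow> 'v::real_normed_vector"
  assumes fin: "finite_dimensional (UNIV :: 'v set)"
    and "Ck_on k T g" "Ck_on k S f" "\<And>x. x \<in> S \<Longrightarrow> f x \<in> T"
  shows "Ck_on k S (\<lambda>x. g (f x))"
  using assms(2,3)
proof (induction k arbitrary: g)
  case 0
  with assms(4) show ?case using continuous_on_compose2[of T g S f] by auto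
next
  case (Suc k)
  then obtain f' g' where d: "\<forall>x\<in>S. (f has_derivative f' x) (at x within S)"
    "\<forall>v. Ck_on k S (\<lambda>x. f' x v)" "\<forall>x\<in>T. (g has_derivative g' x) (at x within T)"
    "\<forall>v. Ck_on k T (\<lambda>x. g' x v)" by auto
  obtain B :: "'v set" and \<kappa> where B: "finite B" "\<And>b. bounded_linear (\<kappa> b)"
    "\<And>v. (\<Sum>b\<in>B. \<kappa> b v *\<^sub>R b) = v"
    using finite_dimensional_coordinates[OF fin] by blast
  have exp: "g' (f x) v = (\<Sum>b\<in>B. \<kappa> b v *\<^sub>R g' (f x) b)" if "x \<in> S" for x v
  proof -
    interpret bounded_linear "g' (f x)"
      using d(3) assms(4)[OF that] has_derivative_bounded_linear by metis
    show ?thesis by (subst B(3)[of v, symmetric]) (simp add: sum scaleR)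
  qed
  show ?case
    unfolding Ck_on.simps
  proof (intro exI[of _ "\<lambda>x v. g' (f x) (f' x v)"] conjI ballI allI)
    show "((\<lambda>x. g (f x)) has_derivative (\<lambda>v. g' (f x) (f' x v))) (at x within S)" if "x \<in> S" for x
    proof (rule has_derivative_in_compose[where f = f])
      show "(f has_derivative f' x) (at x within S)" using d(1) that by blast
      have "(g has_derivative g' (f x)) (at (f x) within T)" using d(3) assms(4) that by blast
      then show "(g has_derivative g' (f x)) (at (f x) within f ` S)"
        by (rule has_derivative_subset) (use assms(4) in blast)
    qed
    fix v
    have "Ck_on k S (\<lambda>x. g' (f x) b)" for b
      using Suc.IH[of "\<lambda>y. g' y b"] d(4) Ck_on_Suc_imp[OF Suc.prems(2)] by blast
    moreover have "Ck_on k S (\<lambda>x. f' x v)" using d(2) by blast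
    ultimately have "Ck_on k S (\<lambda>x. \<Sum>b\<in>B. \<kappa> b (f' x v) *\<^sub>R g' (f x) b)"
      by (intro Ck_on_sum Ck_on_scaleR Ck_on_bounded_linear_apply[OF B(2)])
    then show "Ck_on k S (\<lambda>x. g' (f x) (f' x v))"
      by (rule Ck_on_cong) (rule exp)
  qed
qed

text \<open>The derivative of \<open>x \<mapsto> B x v\<close> is \<open>h \<mapsto> - B x (A' x h (B x v))\<close>, as for matrices.\<close>

lemma Ck_on_inverse_family:
  fixes A B :: "'u::real_normed_vector \<Rightarrow> 'v::real_normed_vector \<Rightarrow> 'v"
  assumes finu: "finite_dimensional (UNIV :: 'u set)" and fin: "finite_dimensional (UNIV :: 'v set)"
    and A: "\<And>v. Ck_on k S (\<lambda>x. A x v)" "\<And>x. x \<in> S \<Longrightarrow> linear (A x)"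
    and B: "\<And>x. x \<in> S \<Longrightarrow> linear (B x)" "\<And>x v. x \<in> S \<Longrightarrow> norm (B x v) \<le> 2 * norm v"
    and AB: "\<And>x v. x \<in> S \<Longrightarrow> A x (B x v) = v" "\<And>x v. x \<in> S \<Longrightarrow> B x (A x v) = v"
  shows "Ck_on k S (\<lambda>x. B x v)"
  using A(1)
proof (induction k arbitrary: v)
  \<comment> \<open>The resolvent identity. With the uniform bound 2 on \<open>B y\<close> it
    reduces continuity of \<open>B\<close> to continuity of \<open>A\<close> at the fixed vector
    \<open>B x v\<close>.\<close>
  have diff: "B y v - B x v = B y (A x (B x v) - A y (B x v))" if "x \<in> S" "y \<in> S" for x y v
    using that by (simp add: linear_diff[OF B(1)] AB)
  case 0
  show ?case
    unfolding Ck_on.simps continuous_on_def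
  proof
    fix x assume "x \<in> S"
    have "((\<lambda>y. 2 * norm (A x (B x v) - A y (B x v))) \<longlongrightarrow>
        2 * norm (A x (B x v) - A x (B x v))) (at x within S)"
      using 0 \<open>x \<in> S\<close> by (intro tendsto_intros) (auto simp: continuous_on_def)
    then have lim: "((\<lambda>y. 2 * norm (A x (B x v) - A y (B x v))) \<longlongrightarrow> 0) (at x within S)" by simp
    have "((\<lambda>y. B y v - B x v) \<longlongrightarrow> 0) (at x within S)"
    proof (rule Lim_null_comparison[OF _ lim])
      show "\<forall>\<^sub>F y in at x within S. norm (B y v - B x v) \<le> 2 * norm (A x (B x v) - A y (B x v))"
        using \<open>x \<in> S\<close> by (auto simp: eventually_at_filter diff B(2))
    qed
    then show "((\<lambda>y. B y v) \<longlongrightarrow> B x v) (at x within S)" by (rule LIM_zero_cancel)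
  qed
next
  case (Suc k)
  have diff: "B y v - B x v = B y (A x (B x v) - A y (B x v))" if "x \<in> S" "y \<in> S" for x y v
    using that by (simp add: linear_diff[OF B(1)] AB)
  obtain E :: "'v set" and \<kappa> where E: "finite E" "\<And>b. bounded_linear (\<kappa> b)"
    "\<And>v. (\<Sum>b\<in>E. \<kappa> b v *\<^sub>R b) = v"
    using finite_dimensional_coordinates[OF fin] by blast
  obtain F :: "'u set" and \<nu> where F: "finite F" "\<And>b. bounded_linear (\<nu> b)"
    "\<And>v. (\<Sum>b\<in>F. \<nu> b v *\<^sub>R b) = v"
    using finite_dimensional_coordinates[OF finu] by blast
  have "\<forall>v. \<exists>A'. (\<forall>x\<in>S. ((\<lambda>x. A x v) has_derivative A' x) (at x within S)) \<and>
      (\<forall>h. Ck_on k S (\<lambda>x. A' x h))"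
    using Suc.prems by simp
  then obtain A' where A': "\<And>v x. x \<in> S \<Longrightarrow> ((\<lambda>x. A x v) has_derivative A' v x) (at x within S)"
    "\<And>v h. Ck_on k S (\<lambda>x. A' v x h)" by metis
  \<comment> \<open>\<open>A'\<close> was chosen for each vector separately, so nothing relates its
    values at different vectors. Rebuilding the derivative from the basis makes it linear in
    \<open>u\<close>, which allows the moving argument \<open>u = B x v\<close> later on.\<close>
  define D where "D x u h = (\<Sum>b\<in>E. \<kappa> b u *\<^sub>R A' b x h)" for x u h
  have Aexp: "A x u = (\<Sum>b\<in>E. \<kappa> b u *\<^sub>R A x b)" if "x \<in> S" for x u
    by (subst E(3)[of u, symmetric]) (simp add: linear_sum[OF A(2)] linear_cmul[OF A(2)] that)
  have Bexp: "B x u = (\<Sum>b\<in>E. \<kappa> b u *\<^sub>R B x b)" if "x \<in> S" for x u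
    by (subst E(3)[of u, symmetric]) (simp add: linear_sum[OF B(1)] linear_cmul[OF B(1)] that)
  have D: "((\<lambda>x. A x u) has_derivative D x u) (at x within S)" if "x \<in> S" for x u
  proof (rule has_derivative_transform[OF that Aexp])
    show "((\<lambda>x. \<Sum>b\<in>E. \<kappa> b u *\<^sub>R A x b) has_derivative D x u) (at x within S)"
      unfolding D_def by (intro has_derivative_sum has_derivative_scaleR_right A' that)
  qed
  have IH: "Ck_on k S (\<lambda>x. B x v)" for v
    using Suc.prems Ck_on_Suc_imp by (intro Suc.IH) blast
  have der: "((\<lambda>x. B x v) has_derivative (\<lambda>h. - B x (D x (B x v) h))) (at x within S)"
    if x: "x \<in> S" for x
  proof -
    define u where "u = B x v"
    interpret D: bounded_linear "D x u" using D[OF x] by (rule has_derivative_bounded_linear)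
    interpret Bx: bounded_linear "B x"
      using fin B(1)[OF x] by (rule finite_dimensional_bounded_linear)
    define R where "R y = (1 / norm (y - x)) *\<^sub>R (A y u - (A x u + D x u (y - x)))" for y
    have R: "(R \<longlongrightarrow> 0) (at x within S)"
      using D[OF x, of u] unfolding has_derivative_within R_def by simp
    \<comment> \<open>At \<open>y = x\<close> the quotient is 0 by the convention for division by
      zero, so the bound holds for all \<open>y\<close>.\<close>
    have "\<exists>K. \<forall>y. \<bar>\<nu> c (y - x)\<bar> / norm (y - x) \<le> K" for c
    proof -
      obtain K where "K \<ge> 0" "\<And>z. norm (\<nu> c z) \<le> norm z * K"
        using bounded_linear.nonneg_bounded[OF F(2)] by blast
      then show ?thesis
        by (intro exI[of _ K] allI) (auto simp: divide_le_eq mult.commute)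
    qed
    then obtain K where K: "\<And>c y. \<bar>\<nu> c (y - x)\<bar> / norm (y - x) \<le> K c" by metis
    \<comment> \<open>The cost of replacing \<open>B y\<close> by \<open>B x\<close> on
      \<open>D x u (y - x)\<close>. Only pointwise continuity of \<open>B\<close> is known at this
      stage, so the moving vector \<open>y - x\<close> is split into coordinates.\<close>
    define Q where "Q y = (\<Sum>c\<in>F. K c * norm (B y (D x u c) - B x (D x u c)))" for y
    have "(Q \<longlongrightarrow> (\<Sum>c\<in>F. K c * norm (B x (D x u c) - B x (D x u c)))) (at x within S)"
      unfolding Q_def using Ck_on_imp_continuous_on[OF IH] x
      by (intro tendsto_intros) (auto simp: continuous_on_def)
    then have Q: "(Q \<longlongrightarrow> 0) (at x within S)" by simp
    have bound: "norm ((1 / norm (y - x)) *\<^sub>R (B y v - (B x v + - B x (D x u (y - x)))))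
        \<le> 2 * norm (R y) + Q y" if y: "y \<in> S" for y
    proof -
      have lin: "linear (B y)" using B(1)[OF y] .
      have eq: "B y v - (B x v + - B x (D x u (y - x))) =
          - B y (A y u - (A x u + D x u (y - x)))
          - (B y (D x u (y - x)) - B x (D x u (y - x)))"
        using diff[OF x y, of v, folded u_def]
        by (simp add: u_def[symmetric] linear_diff[OF lin] linear_add[OF lin] algebra_simps)
      have BR: "B y (R y) = (1 / norm (y - x)) *\<^sub>R B y (A y u - (A x u + D x u (y - x)))"
        unfolding R_def by (rule linear_cmul[OF lin])
      define q where "q = B y (D x u (y - x)) - B x (D x u (y - x))"
      have "(1 / norm (y - x)) *\<^sub>R (B y v - (B x v + - B x (D x u (y - x)))) =
          - B y (R y) - (1 / norm (y - x)) *\<^sub>R q"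
        unfolding eq BR q_def[symmetric] by (simp add: scaleR_diff_right)
      then have tri: "norm ((1 / norm (y - x)) *\<^sub>R (B y v - (B x v + - B x (D x u (y - x)))))
          \<le> norm (B y (R y)) + norm ((1 / norm (y - x)) *\<^sub>R q)"
        by (metis norm_minus_cancel norm_triangle_ineq4)
      have "q = (\<Sum>c\<in>F. \<nu> c (y - x) *\<^sub>R (B y (D x u c) - B x (D x u c)))"
        unfolding q_def
        by (subst (1 2) F(3)[of "y - x", symmetric])
          (simp add: D.sum D.scaleR Bx.sum Bx.scaleR linear_sum[OF lin] linear_cmul[OF lin]
            scaleR_diff_right sum_subtractf)
      then have "norm ((1 / norm (y - x)) *\<^sub>R q) \<le> Q y"
        unfolding Q_def scaleR_sum_right
      proof (simp only: scaleR_sum_right, intro sum_norm_le)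
        fix c
        show "norm ((1 / norm (y - x)) *\<^sub>R \<nu> c (y - x) *\<^sub>R (B y (D x u c) - B x (D x u c)))
            \<le> K c * norm (B y (D x u c) - B x (D x u c))"
          using mult_right_mono[OF K[of c y] norm_ge_zero[of "B y (D x u c) - B x (D x u c)"]]
          by simp
      qed
      with tri B(2)[OF y, of "R y"] show ?thesis by linarith
    qed
    have "((\<lambda>y. (1 / norm (y - x)) *\<^sub>R (B y v - (B x v + - B x (D x u (y - x))))) \<longlongrightarrow> 0)
        (at x within S)"
    proof (rule Lim_null_comparison)
      show "((\<lambda>y. 2 * norm (R y) + Q y) \<longlongrightarrow> 0) (at x within S)"
        using tendsto_add[OF tendsto_mult_left[OF tendsto_norm[OF R], of 2] Q] by simp
      show "\<forall>\<^sub>F y in at x within S.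
          norm ((1 / norm (y - x)) *\<^sub>R (B y v - (B x v + - B x (D x u (y - x)))))
            \<le> 2 * norm (R y) + Q y"
        using bound by (auto simp: eventually_at_filter)
    qed
    moreover have "bounded_linear (\<lambda>h. - B x (D x u h))"
      by (intro bounded_linear_minus bounded_linear_compose[OF Bx.bounded_linear_axioms]
          D.bounded_linear_axioms)
    ultimately show ?thesis unfolding has_derivative_within u_def by simp
  qed
  have "Ck_on k S (\<lambda>x. - B x (D x (B x v) h))" for h
  proof (rule Ck_on_cong)
    show "Ck_on k S (\<lambda>x. - (\<Sum>b\<in>E. \<kappa> b (B x v) *\<^sub>R (\<Sum>c\<in>E. \<kappa> c (A' b x h) *\<^sub>R B x c)))"
      by (intro Ck_on_bounded_linear_apply[OF bounded_linear_minus[OF bounded_linear_ident]]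
          Ck_on_sum Ck_on_scaleR Ck_on_bounded_linear_apply[OF E(2)] IH A'(2))
    show "- B x (D x (B x v) h) =
        - (\<Sum>b\<in>E. \<kappa> b (B x v) *\<^sub>R (\<Sum>c\<in>E. \<kappa> c (A' b x h) *\<^sub>R B x c))" if "x \<in> S" for x
      by (simp add: D_def linear_sum[OF B(1)] linear_cmul[OF B(1)] that Bexp[OF that, symmetric])
  qed
  with der show ?case
    unfolding Ck_on.simps by (intro exI[of _ "\<lambda>x h. - B x (D x (B x v) h)"]) blast
qed

section \<open>The inverse function theorem\<close>

text \<open>A solution is a fixed point of \<open>x \<mapsto> y - (T x - x)\<close>, a contraction
  with factor 1/2. The ball is preserved because the contraction uses up half of the radius and
  \<open>y - T x0\<close> the other half.\<close>

lemma lipschitz_perturbation_of_identity_surj: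
  fixes T :: "'w::real_normed_vector \<Rightarrow> 'w"
  assumes fin: "finite_dimensional (UNIV :: 'w set)"
    and lip: "\<And>x y. x \<in> cball x0 r \<Longrightarrow> y \<in> cball x0 r \<Longrightarrow> norm ((T x - x) - (T y - y)) \<le> norm (x - y) / 2"
    and y: "norm (y - T x0) \<le> r / 2"
  shows "\<exists>x\<in>cball x0 r. T x = y"
proof -
  have "r \<ge> 0" using y norm_ge_zero[of "y - T x0"] by linarith
  have "complete (UNIV \<inter> cball x0 r)"
    by (intro complete_Int_closed finite_dimensional_complete fin closed_cball)
  then have "\<exists>!x\<in>cball x0 r. y - (T x - x) = x"
  proof (intro Banach_fix[where c = "1/2"])
    show "(\<lambda>x. y - (T x - x)) ` cball x0 r \<subseteq> cball x0 r"
    proof safe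
      fix x assume x: "x \<in> cball x0 r"
      have "x0 - (y - (T x - x)) = ((T x - x) - (T x0 - x0)) - (y - T x0)" by simp
      then have "norm (x0 - (y - (T x - x))) \<le> norm ((T x - x) - (T x0 - x0)) + norm (y - T x0)"
        by (metis norm_triangle_ineq4)
      also have "\<dots> \<le> norm (x - x0) / 2 + r / 2"
        using lip[OF x, of x0] y \<open>r \<ge> 0\<close> by simp
      also have "\<dots> \<le> r" using x by (simp add: dist_norm norm_minus_commute)
      finally show "y - (T x - x) \<in> cball x0 r" by (simp add: dist_norm)
    qed
    fix u v assume "u \<in> cball x0 r" "v \<in> cball x0 r"
    with lip[of v u] show "dist (y - (T u - u)) (y - (T v - v)) \<le> 1 / 2 * dist u v"
      by (simp add: dist_norm norm_minus_commute algebra_simps)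
  qed (use \<open>r \<ge> 0\<close> in auto)
  then obtain x where "x \<in> cball x0 r" "y - (T x - x) = x" by blast
  then show ?thesis by (intro bexI[of _ x]) (auto simp: algebra_simps)
qed

text \<open>From \<open>norm v \<le> norm (A v) + norm v / 2\<close> come injectivity and the bound
  2, the one demanded by \<open>Ck_on_inverse_family\<close>.\<close>

lemma near_identity_linear_inverse:
  fixes A :: "'w::real_normed_vector \<Rightarrow> 'w"
  assumes fin: "finite_dimensional (UNIV :: 'w set)"
    and A: "linear A" "\<And>v. norm (A v - v) \<le> norm v / 2"
  obtains B where "linear B" "\<And>v. norm (B v) \<le> 2 * norm v" "\<And>v. A (B v) = v" "\<And>v. B (A v) = v"
proof -
  interpret A: linear A by (rule A(1))
  have lower: "norm v \<le> 2 * norm (A v)" for v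
    using A(2)[of v] norm_triangle_ineq2[of v "v - A v"] by (simp add: norm_minus_commute)
  have inj: "u = v" if "A u = A v" for u v
    using lower[of "u - v"] that by (simp add: A.diff)
  have "\<exists>x. A x = y" for y
  proof -
    \<comment> \<open>The radius is chosen so that \<open>y - A 0\<close> has norm exactly half of
      it.\<close>
    have "\<exists>x\<in>cball 0 (2 * norm y). A x = y"
    proof (rule lipschitz_perturbation_of_identity_surj[OF fin])
      show "norm ((A u - u) - (A v - v)) \<le> norm (u - v) / 2" for u v
        using A(2)[of "u - v"] by (simp add: A.diff algebra_simps)
    qed simp
    then show ?thesis by blast
  qed
  then obtain B where AB: "\<And>v. A (B v) = v" by metis
  have "linear B"
    by (rule linearI; rule inj; simp add: AB A.add A.scale)
  moreover have "norm (B v) \<le> 2 * norm v" for v using lower[of "B v"] by (simp add: AB)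
  moreover have "B (A v) = v" for v by (rule inj) (rule AB)
  ultimately show thesis using that AB by blast
qed

text \<open>\<open>Ck_on\<close> only controls directional derivatives; finite dimension upgrades this to the operator norm.\<close>

lemma C1_imp_derivative_close:
  fixes \<Psi>' :: "'w::real_normed_vector \<Rightarrow> 'w \<Rightarrow> 'z::real_normed_vector"
  assumes fin: "finite_dimensional (UNIV :: 'w set)"
    and S: "open S" "x0 \<in> S"
    and lin: "\<And>x. x \<in> S \<Longrightarrow> linear (\<Psi>' x)" and cont: "\<And>v. continuous_on S (\<lambda>x. \<Psi>' x v)"
    and "e > 0"
  shows "\<exists>d>0. cball x0 d \<subseteq> S \<and> (\<forall>x\<in>cball x0 d. \<forall>v. norm (\<Psi>' x v - \<Psi>' x0 v) \<le> e * norm v)"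
proof -
  obtain E :: "'w set" and \<kappa> where E: "finite E" "\<And>b. bounded_linear (\<kappa> b)"
    "\<And>v. (\<Sum>b\<in>E. \<kappa> b v *\<^sub>R b) = v"
    using finite_dimensional_coordinates[OF fin] by blast
  have "\<forall>b. \<exists>K. K \<ge> 0 \<and> (\<forall>v. norm (\<kappa> b v) \<le> norm v * K)"
    using bounded_linear.nonneg_bounded[OF E(2)] by metis
  then obtain K where K: "\<And>b. K b \<ge> 0" "\<And>b v. norm (\<kappa> b v) \<le> norm v * K b" by metis
  \<comment> \<open>\<open>q x\<close> bounds the operator norm of
    \<open>\<Psi>' x - \<Psi>' x0\<close>, and as a finite sum over basis vectors it inherits
    continuity from the directional derivatives.\<close>
  define q where "q x = (\<Sum>b\<in>E. K b * norm (\<Psi>' x b - \<Psi>' x0 b))" for x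
  have "continuous_on S q" unfolding q_def by (intro continuous_intros cont)
  then have "open (S \<inter> q -` {..<e})"
    using S(1) by (intro continuous_open_preimage) auto
  moreover have "x0 \<in> S \<inter> q -` {..<e}" using S(2) \<open>e > 0\<close> by (simp add: q_def)
  ultimately obtain d where d: "d > 0" "cball x0 d \<subseteq> S \<inter> q -` {..<e}"
    using open_contains_cball by metis
  have "norm (\<Psi>' x v - \<Psi>' x0 v) \<le> e * norm v" if x: "x \<in> cball x0 d" for x v
  proof -
    have "x \<in> S" "q x \<le> e" using d(2) x by (auto dest: subsetD)
    have "\<Psi>' x v - \<Psi>' x0 v = (\<Sum>b\<in>E. \<kappa> b v *\<^sub>R (\<Psi>' x b - \<Psi>' x0 b))"
      by (subst (1 2) E(3)[of v, symmetric])
        (simp add: linear_sum[OF lin] linear_cmul[OF lin] \<open>x \<in> S\<close> S(2) scaleR_diff_right sum_subtractf)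
    also have "norm \<dots> \<le> (\<Sum>b\<in>E. norm v * (K b * norm (\<Psi>' x b - \<Psi>' x0 b)))"
    proof (rule sum_norm_le)
      fix b
      show "norm (\<kappa> b v *\<^sub>R (\<Psi>' x b - \<Psi>' x0 b)) \<le> norm v * (K b * norm (\<Psi>' x b - \<Psi>' x0 b))"
        using mult_right_mono[OF K(2)[of b v] norm_ge_zero[of "\<Psi>' x b - \<Psi>' x0 b"]]
        by (simp add: mult.assoc)
    qed
    also have "\<dots> = norm v * q x" by (simp add: q_def sum_distrib_left)
    also have "\<dots> \<le> e * norm v" using mult_right_mono[OF \<open>q x \<le> e\<close> norm_ge_zero[of v]] by (simp add: mult.commute)
    finally show ?thesis .
  qed
  with d show ?thesis by (intro exI[of _ d]) auto
qed

text \<open>\<open>Ck_on\<close> lets the derivative be a different witness for each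
  \<open>k\<close>. On an open set derivatives are unique, so a single \<open>f'\<close> serves all
  classes.\<close>

lemma smooth_on_derivative:
  assumes S: "open S" and f: "smooth_on S f"
  obtains f' where "\<And>x. x \<in> S \<Longrightarrow> (f has_derivative f' x) (at x)"
    "\<And>k v. Ck_on k S (\<lambda>x. f' x v)"
proof -
  have ex: "\<exists>f'. (\<forall>x\<in>S. (f has_derivative f' x) (at x)) \<and> (\<forall>v. Ck_on k S (\<lambda>x. f' x v))" for k
  proof -
    have "Ck_on (Suc k) S f" using f by (simp only: smooth_on_def)
    then show ?thesis using at_within_open[OF _ S] by (simp cong: ball_cong)
  qed
  from ex[of 0] obtain f' where f': "\<forall>x\<in>S. (f has_derivative f' x) (at x)" by blast
  have "Ck_on k S (\<lambda>x. f' x v)" for k v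
  proof -
    obtain g where g: "\<forall>x\<in>S. (f has_derivative g x) (at x)" "\<forall>v. Ck_on k S (\<lambda>x. g x v)"
      using ex[of k] by blast
    show ?thesis
      by (rule Ck_on_cong[OF spec[OF g(2), of v]]) (metis f' g(1) has_derivative_unique)
  qed
  with f' that show thesis by blast
qed

text \<open>The Lipschitz estimate for \<open>\<Psi> x - x\<close> gives preimages and makes
  \<open>G\<close> Lipschitz with constant 2. Smoothness is a bootstrap: the derivative of
  \<open>G\<close> is \<open>B (G y)\<close> with \<open>B\<close> the inverse of
  \<open>\<Psi>'\<close>, so class \<open>k\<close> for \<open>G\<close> implies class
  \<open>k + 1\<close>.\<close>

lemma smooth_inverse_function:
  fixes \<Psi> :: "'w::real_normed_vector \<Rightarrow> 'w"
  assumes fin: "finite_dimensional (UNIV :: 'w set)"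
    and S: "open S" "x0 \<in> S" and smooth: "smooth_on S \<Psi>"
    and id: "(\<Psi> has_derivative (\<lambda>v. v)) (at x0)"
  obtains U G where "open U" "\<Psi> x0 \<in> U" "smooth_on U G" "G ` U \<subseteq> S" "\<And>y. y \<in> U \<Longrightarrow> \<Psi> (G y) = y"
proof -
  obtain \<Psi>' where \<Psi>': "\<And>x. x \<in> S \<Longrightarrow> (\<Psi> has_derivative \<Psi>' x) (at x)"
    "\<And>k v. Ck_on k S (\<lambda>x. \<Psi>' x v)"
    using smooth_on_derivative[OF S(1) smooth] by blast
  have lin: "linear (\<Psi>' x)" if "x \<in> S" for x
    using \<Psi>'(1)[OF that] by (simp add: bounded_linear.linear has_derivative_bounded_linear)
  have \<Psi>'0: "\<Psi>' x0 = (\<lambda>v. v)" using has_derivative_unique[OF \<Psi>'(1)[OF S(2)] id] .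
  obtain d where d: "d > 0" "cball x0 d \<subseteq> S"
    and near: "\<And>x v. x \<in> cball x0 d \<Longrightarrow> norm (\<Psi>' x v - v) \<le> norm v / 2"
    using C1_imp_derivative_close[OF fin S lin Ck_on_imp_continuous_on[OF \<Psi>'(2)], of "1/2"]
    unfolding \<Psi>'0 by auto
  have lip: "norm ((\<Psi> x - x) - (\<Psi> y - y)) \<le> norm (x - y) / 2"
    if "x \<in> cball x0 d" "y \<in> cball x0 d" for x y
  proof -
    have "norm ((\<Psi> x - x) - (\<Psi> y - y)) \<le> 1/2 * norm (x - y)"
    proof (rule differentiable_bound[OF convex_cball _ _ that, of "\<lambda>x. \<Psi> x - x" "\<lambda>x v. \<Psi>' x v - v"])
      fix x assume x: "x \<in> cball x0 d"
      show "((\<lambda>x. \<Psi> x - x) has_derivative (\<lambda>v. \<Psi>' x v - v)) (at x within cball x0 d)"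
        using x d(2) by (intro has_derivative_diff has_derivative_at_withinI[OF \<Psi>'(1)]) auto
      show "onorm (\<lambda>v. \<Psi>' x v - v) \<le> 1/2"
        using near[OF x] by (intro onorm_bound) auto
    qed
    then show ?thesis by simp
  qed
  have inj: "norm (x - y) \<le> 2 * norm (\<Psi> x - \<Psi> y)" if "x \<in> cball x0 d" "y \<in> cball x0 d" for x y
  proof -
    have "x - y = (\<Psi> x - \<Psi> y) - ((\<Psi> x - x) - (\<Psi> y - y))" by simp
    then have "norm (x - y) \<le> norm (\<Psi> x - \<Psi> y) + norm ((\<Psi> x - x) - (\<Psi> y - y))"
      by (metis norm_triangle_ineq4)
    with lip[OF that] show ?thesis by linarith
  qed
  define U where "U = ball (\<Psi> x0) (d / 2)"
  have "\<exists>x. x \<in> cball x0 d \<and> \<Psi> x = y" if "y \<in> U" for y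
    using lipschitz_perturbation_of_identity_surj[of x0 d \<Psi> y, OF fin lip] that
    by (auto simp: U_def dist_norm norm_minus_commute)
  then obtain G where G: "\<And>y. y \<in> U \<Longrightarrow> G y \<in> cball x0 d" "\<And>y. y \<in> U \<Longrightarrow> \<Psi> (G y) = y"
    by metis
  have G_lip: "norm (G y - G z) \<le> 2 * norm (y - z)" if "y \<in> U" "z \<in> U" for y z
    using inj[of "G y" "G z"] G that by simp
  have U: "open U" "\<Psi> x0 \<in> U" using d(1) by (auto simp: U_def)
  have GS: "G y \<in> S" if "y \<in> U" for y using G(1)[OF that] d(2) by blast
  have G_cont: "continuous_on U G"
    by (rule lipschitz_on_continuous_on[of 2]) (use G_lip in \<open>auto simp: lipschitz_on_def dist_norm\<close>)
  have "\<exists>B. linear B \<and> (\<forall>v. norm (B v) \<le> 2 * norm v) \<and> (\<forall>v. \<Psi>' x (B v) = v) \<and> (\<forall>v. B (\<Psi>' x v) = v)"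
    if "x \<in> cball x0 d" for x
    using near_identity_linear_inverse[OF fin lin near, of x] that d(2) by (metis subsetD)
  then obtain B where B: "\<And>x. x \<in> cball x0 d \<Longrightarrow> linear (B x)"
    "\<And>x v. x \<in> cball x0 d \<Longrightarrow> norm (B x v) \<le> 2 * norm v"
    "\<And>x v. x \<in> cball x0 d \<Longrightarrow> \<Psi>' x (B x v) = v" "\<And>x v. x \<in> cball x0 d \<Longrightarrow> B x (\<Psi>' x v) = v"
    by metis
  have B_Ck: "Ck_on k (cball x0 d) (\<lambda>x. B x v)" for k v
  proof (rule Ck_on_inverse_family[OF fin fin, where A = \<Psi>'])
    show "Ck_on k (cball x0 d) (\<lambda>x. \<Psi>' x v)" for v using \<Psi>'(2) d(2) by (rule Ck_on_subset)
    show "linear (\<Psi>' x)" if "x \<in> cball x0 d" for x using lin that d(2) by blast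
  qed (use B in auto)
  have der: "(G has_derivative B (G y)) (at y)" if y: "y \<in> U" for y
  proof (rule has_derivative_inverse_basic[OF \<Psi>'(1)[OF GS[OF y]] _ _ _ U(1) y G(2)])
    show "bounded_linear (B (G y))"
      using fin B(1)[OF G(1)[OF y]] by (rule finite_dimensional_bounded_linear)
    show "B (G y) \<circ> \<Psi>' (G y) = id" using B(4)[OF G(1)[OF y]] by (auto simp: fun_eq_iff)
    show "continuous (at y) G" using G_cont y U(1) by (simp add: continuous_on_eq_continuous_at)
  qed
  have "Ck_on k U G" for k
  proof (induction k)
    case 0
    show ?case using G_cont by simp
  next
    case (Suc k)
    have "Ck_on k U (\<lambda>y. B (G y) v)" for v
      using fin B_Ck Suc G(1) by (rule Ck_on_compose)
    then show ?case
      unfolding Ck_on.simps using der has_derivative_at_withinI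
      by (intro exI[of _ "\<lambda>y. B (G y)"]) blast
  qed
  then have "smooth_on U G" by (simp add: smooth_on_def)
  with that U G GS show thesis by blast
qed

section \<open>Rigidity of morphisms transverse to the coboundaries\<close>

lemma finite_dimensional_range:
  assumes "finite_dimensional (UNIV :: 'v::real_vector set)" "linear (T :: 'v \<Rightarrow> 'w::real_vector)"
  shows "finite_dimensional (range T)"
proof -
  obtain B :: "'v set" where "finite B" "UNIV = span B"
    using assms(1) by (auto simp: finite_dimensional_def)
  then show ?thesis
    using linear_span_image[OF assms(2), of B] by (auto simp: finite_dimensional_def)
qed

section \<open>Trilinear maps as bounded operators\<close>

definition trilinear :: "('a::real_vector \<Rightarrow> 'a \<Rightarrow> 'a \<Rightarrow> 'w::real_vector) \<Rightarrow> bool" where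
  "trilinear \<beta> \<longleftrightarrow> (\<forall>y z. linear (\<lambda>x. \<beta> x y z)) \<and> (\<forall>x z. linear (\<lambda>y. \<beta> x y z)) \<and>
     (\<forall>x y. linear (\<lambda>z. \<beta> x y z))"

lemma trilinear_simps:
  assumes "trilinear \<beta>"
  shows "\<beta> (x + x') y z = \<beta> x y z + \<beta> x' y z" "\<beta> x (y + y') z = \<beta> x y z + \<beta> x y' z"
    "\<beta> x y (z + z') = \<beta> x y z + \<beta> x y z'"
    "\<beta> (c *\<^sub>R x) y z = c *\<^sub>R \<beta> x y z" "\<beta> x (c *\<^sub>R y) z = c *\<^sub>R \<beta> x y z"
    "\<beta> x y (c *\<^sub>R z) = c *\<^sub>R \<beta> x y z"
    "\<beta> 0 y z = 0" "\<beta> x 0 z = 0" "\<beta> x y 0 = 0"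
proof -
  have 1: "linear (\<lambda>x. \<beta> x y z)" and 2: "linear (\<lambda>y. \<beta> x y z)" and 3: "linear (\<lambda>z. \<beta> x y z)" for x y z
    using assms by (auto simp: trilinear_def)
  show "\<beta> (x + x') y z = \<beta> x y z + \<beta> x' y z" "\<beta> (c *\<^sub>R x) y z = c *\<^sub>R \<beta> x y z" "\<beta> 0 y z = 0"
    using linear_add[OF 1] linear_cmul[OF 1] linear_0[OF 1] by auto
  show "\<beta> x (y + y') z = \<beta> x y z + \<beta> x y' z" "\<beta> x (c *\<^sub>R y) z = c *\<^sub>R \<beta> x y z" "\<beta> x 0 z = 0"
    using linear_add[OF 2] linear_cmul[OF 2] linear_0[OF 2] by auto
  show "\<beta> x y (z + z') = \<beta> x y z + \<beta> x y z'" "\<beta> x y (c *\<^sub>R z) = c *\<^sub>R \<beta> x y z" "\<beta> x y 0 = 0"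
    using linear_add[OF 3] linear_cmul[OF 3] linear_0[OF 3] by auto
qed

lemma three_Lie_algebra_trilinear: "three_Lie_algebra \<mu> \<Longrightarrow> trilinear \<mu>"
  by (simp add: three_Lie_algebra_def alternating_trilinear_def trilinear_def)

text \<open>Iterated currying turns a cochain such as \<open>delta1 \<pi> \<mu> f \<theta>\<close>
  into a point of a normed space, so that \<open>finite_dimensional_bounded_below\<close> can be
  applied to the coboundary operator.\<close>

definition trilinear_blinfun ::
  "('a::real_normed_vector \<Rightarrow> 'a \<Rightarrow> 'a \<Rightarrow> 'w::real_normed_vector) \<Rightarrow> 'a \<Rightarrow>\<^sub>L 'a \<Rightarrow>\<^sub>L 'a \<Rightarrow>\<^sub>L 'w" where
  "trilinear_blinfun \<beta> = Blinfun (\<lambda>x. Blinfun (\<lambda>y. Blinfun (\<lambda>z. \<beta> x y z)))"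

lemma trilinear_blinfun_apply:
  fixes \<beta> :: "'a::real_normed_vector \<Rightarrow> 'a \<Rightarrow> 'a \<Rightarrow> 'w::real_normed_vector"
  assumes fin: "finite_dimensional (UNIV :: 'a set)" and \<beta>: "trilinear \<beta>"
  shows "blinfun_apply (blinfun_apply (blinfun_apply (trilinear_blinfun \<beta>) x) y) z = \<beta> x y z"
proof -
  have Blinfun: "blinfun_apply (Blinfun L) x = L x" if "linear L" for L :: "'a \<Rightarrow> 'c::real_normed_vector" and x
    using bounded_linear_Blinfun_apply[OF finite_dimensional_bounded_linear[OF fin that]] by simp
  have 1: "blinfun_apply (Blinfun (\<lambda>z. \<beta> x y z)) z = \<beta> x y z" for x y z
    by (rule Blinfun) (use \<beta> in \<open>simp add: trilinear_def\<close>)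
  have "linear (\<lambda>y. Blinfun (\<lambda>z. \<beta> x y z))" for x
    by (intro linearI blinfun_eqI)
      (simp_all only: 1 blinfun.add_left blinfun.scaleR_left, simp_all only: trilinear_simps[OF \<beta>])
  note 2 = Blinfun[OF this]
  have "linear (\<lambda>x. Blinfun (\<lambda>y. Blinfun (\<lambda>z. \<beta> x y z)))"
    by (intro linearI blinfun_eqI)
      (simp_all only: 1 2 blinfun.add_left blinfun.scaleR_left, simp_all only: trilinear_simps[OF \<beta>])
  note 3 = Blinfun[OF this]
  show ?thesis by (simp only: trilinear_blinfun_def 1 2 3)
qed

lemma trilinear_bounded:
  fixes \<beta> :: "'a::real_normed_vector \<Rightarrow> 'a \<Rightarrow> 'a \<Rightarrow> 'w::real_normed_vector"
  assumes fin: "finite_dimensional (UNIV :: 'a set)" and \<beta>: "trilinear \<beta>"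
  obtains K where "K > 0" "\<And>x y z. norm (\<beta> x y z) \<le> K * norm x * norm y * norm z"
proof
  let ?b = "trilinear_blinfun \<beta>"
  show "norm ?b + 1 > 0" by (simp add: add_nonneg_pos)
  fix x y z
  have "norm (\<beta> x y z) = norm (blinfun_apply (blinfun_apply (blinfun_apply ?b x) y) z)"
    by (simp add: trilinear_blinfun_apply[OF assms])
  also have "\<dots> \<le> norm (blinfun_apply (blinfun_apply ?b x) y) * norm z" by (rule norm_blinfun)
  also have "\<dots> \<le> (norm (blinfun_apply ?b x) * norm y) * norm z"
    by (intro mult_right_mono norm_blinfun norm_ge_zero)
  also have "\<dots> \<le> ((norm ?b * norm x) * norm y) * norm z"
    by (intro mult_right_mono norm_blinfun norm_ge_zero)
  also have "\<dots> \<le> (((norm ?b + 1) * norm x) * norm y) * norm z"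
    by (intro mult_right_mono norm_ge_zero) simp
  finally show "norm (\<beta> x y z) \<le> (norm ?b + 1) * norm x * norm y * norm z" .
qed

lemma norm_trilinear_blinfun_le:
  fixes \<beta> :: "'a::real_normed_vector \<Rightarrow> 'a \<Rightarrow> 'a \<Rightarrow> 'w::real_normed_vector"
  assumes "finite_dimensional (UNIV :: 'a set)" "trilinear \<beta>" "K \<ge> 0"
    and "\<And>x y z. norm (\<beta> x y z) \<le> K * norm x * norm y * norm z"
  shows "norm (trilinear_blinfun \<beta>) \<le> K"
proof -
  let ?b = "trilinear_blinfun \<beta>"
  have "norm (blinfun_apply (blinfun_apply (blinfun_apply ?b x) y) z) \<le> K * norm x * norm y * norm z"
    for x y z
    unfolding trilinear_blinfun_apply[OF assms(1,2)] by (rule assms(4))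
  then have "norm (blinfun_apply (blinfun_apply ?b x) y) \<le> K * norm x * norm y" for x y
    using \<open>K \<ge> 0\<close> by - (rule norm_blinfun_bound, simp_all)
  then have "norm (blinfun_apply ?b x) \<le> K * norm x" for x
    using \<open>K \<ge> 0\<close> by - (rule norm_blinfun_bound, simp_all)
  then show ?thesis
    using \<open>K \<ge> 0\<close> by - (rule norm_blinfun_bound, simp_all)
qed

section \<open>Inner derivations and coboundaries\<close>

lemma alternating_bilinear_bracket:
  "three_Lie_algebra \<pi> \<Longrightarrow> alternating_bilinear (\<lambda>x y. \<pi> x y z)"
  by (simp add: three_Lie_algebra_def alternating_trilinear_def alternating_bilinear_def)

lemma alternating_bilinear_blinfun_bracket:
  fixes f :: "'a::real_normed_vector \<Rightarrow>\<^sub>L 'b::real_normed_vector"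
  assumes "three_Lie_algebra \<pi>"
  shows "alternating_bilinear (\<lambda>x y. blinfun_apply f (\<pi> x y z))"
  using assms linear_compose[OF _ bounded_linear.linear[OF blinfun.bounded_linear_right], of _ f]
  by (auto simp: three_Lie_algebra_def alternating_trilinear_def alternating_bilinear_def o_def
      blinfun.zero_right)

lemma ad_abs_bivector:
  assumes "three_Lie_algebra \<mu>"
  shows "ad \<mu> (abs_bivector xs) z = (\<Sum>(u, v)\<leftarrow>xs. \<mu> u v z)"
  unfolding ad_def using alternating_bilinear_bracket[OF assms] by (rule ext_bivector_abs)

lemma abs_bivector_surj: "\<exists>xs. X = abs_bivector xs"
  by (metis Quotient3_abs_rep[OF Quotient3_bivector])

lemma ad_linear:
  assumes "three_Lie_algebra \<mu>"
  shows "linear (ad \<mu> \<U>)"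
proof -
  obtain us where us: "\<U> = abs_bivector us" using abs_bivector_surj by blast
  have "linear (\<lambda>z. \<Sum>(u, v)\<leftarrow>us. \<mu> u v z)"
    using three_Lie_algebra_trilinear[OF assms]
    by (induction us) (auto simp: trilinear_def module_hom_zero intro!: linear_compose_add)
  then show ?thesis by (simp add: us ad_abs_bivector[OF assms, abs_def])
qed

text \<open>For a single pair \<open>u\<close>, \<open>v\<close> this is the fundamental identity of
  \<open>\<mu>\<close>, and derivations are closed under sums.\<close>

lemma InnDer_derivation:
  assumes \<mu>: "three_Lie_algebra \<mu>" and D: "D \<in> InnDer \<mu>"
  shows "blinfun_apply D (\<mu> x y z) =
    \<mu> (blinfun_apply D x) y z + \<mu> x (blinfun_apply D y) z + \<mu> x y (blinfun_apply D z)"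
proof -
  note simps = trilinear_simps[OF three_Lie_algebra_trilinear[OF \<mu>]]
  obtain \<U> where "blinfun_apply D = ad \<mu> \<U>" using D by (auto simp: InnDer_def)
  moreover obtain us where "\<U> = abs_bivector us" using abs_bivector_surj by blast
  ultimately have us: "blinfun_apply D = ad \<mu> (abs_bivector us)" by simp
  have fundamental: "\<mu> u v (\<mu> x y z) = \<mu> (\<mu> u v x) y z + \<mu> x (\<mu> u v y) z + \<mu> x y (\<mu> u v z)" for u v
    using \<mu> unfolding three_Lie_algebra_def by blast
  show ?thesis
    unfolding us ad_abs_bivector[OF \<mu>]
  proof (induction us)
    case (Cons p us)
    obtain u v where "p = (u, v)" by (cases p)
    with Cons fundamental[of u v] show ?case by (simp add: simps)
  qed (simp add: simps)
qed

lemma zero_in_B1: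
  assumes "three_Lie_algebra \<pi>" "three_Lie_algebra \<mu>"
  shows "0 \<in> B1 \<pi> \<mu> f"
proof -
  note zero = linear_0[OF ext_bivector_linear(1)]
  have "delta0 \<pi> \<mu> f (0, 0) = (\<lambda>z. 0)"
    by (rule ext)
      (simp add: delta0_def zero[OF alternating_bilinear_bracket[OF assms(2)]]
        zero[OF alternating_bilinear_blinfun_bracket[OF assms(1)]])
  then have "blinfun_apply 0 = delta0 \<pi> \<mu> f (0, 0)" by (simp add: zero_blinfun.rep_eq)
  then show ?thesis unfolding B1_def by blast
qed

text \<open>A coboundary of \<open>\<X>\<close> alone is inner, since \<open>f (\<pi> x y z) = ad (f x \<and> f y) (f z)\<close>.\<close>

lemma B1_inner:
  fixes f :: "'a::real_normed_vector \<Rightarrow>\<^sub>L 'b::real_normed_vector"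
  assumes fin: "finite_dimensional (UNIV :: 'b set)"
    and \<pi>: "three_Lie_algebra \<pi>" and \<mu>: "three_Lie_algebra \<mu>" and f: "three_Lie_morphism \<pi> \<mu> f"
    and \<theta>: "\<theta> \<in> B1 \<pi> \<mu> f"
  shows "\<exists>D\<in>InnDer \<mu>. \<theta> = D o\<^sub>L f"
proof -
  obtain \<X> \<U> where "blinfun_apply \<theta> = delta0 \<pi> \<mu> f (\<X>, \<U>)"
    using \<theta> by (auto simp: B1_def)
  moreover obtain xs where xs: "\<X> = abs_bivector xs" using abs_bivector_surj by blast
  moreover obtain us where us: "\<U> = abs_bivector us" using abs_bivector_surj by blast
  ultimately have \<theta>z: "blinfun_apply \<theta> z = ad \<mu> (abs_bivector us) (blinfun_apply f z) -
      ext_bivector (\<lambda>x y. blinfun_apply f (\<pi> x y z)) (abs_bivector xs)" for z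
    by (simp add: delta0_def ad_def)
  \<comment> \<open>The minus sign in front of the \<open>\<X>\<close> part of \<open>delta0\<close>
    is absorbed into the first vector of each pair, so that appending lists represents the whole
    bivector.\<close>
  define ys where "ys = map (\<lambda>(x, y). (- blinfun_apply f x, blinfun_apply f y)) xs"
  have "ext_bivector (\<lambda>x y. blinfun_apply f (\<pi> x y z)) (abs_bivector xs) =
      (\<Sum>(x, y)\<leftarrow>xs. blinfun_apply f (\<pi> x y z))" for z
    using alternating_bilinear_blinfun_bracket[OF \<pi>] by (rule ext_bivector_abs)
  moreover have "(\<Sum>(x, y)\<leftarrow>xs. blinfun_apply f (\<pi> x y z)) = - (\<Sum>(u, v)\<leftarrow>ys. \<mu> u v (blinfun_apply f z))" for z
  proof -
    have neg: "\<mu> (- u) v w = - \<mu> u v w" for u v w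
      using trilinear_simps(4)[OF three_Lie_algebra_trilinear[OF \<mu>], of "-1"] by simp
    show ?thesis
      unfolding ys_def using f
      by (induction xs) (auto simp: neg three_Lie_morphism_def)
  qed
  ultimately have "blinfun_apply \<theta> z = ad \<mu> (abs_bivector (us @ ys)) (blinfun_apply f z)" for z
    by (simp add: \<theta>z ad_abs_bivector[OF \<mu>])
  moreover have D: "blinfun_apply (Blinfun (ad \<mu> (abs_bivector (us @ ys)))) = ad \<mu> (abs_bivector (us @ ys))"
    by (intro bounded_linear_Blinfun_apply finite_dimensional_bounded_linear[OF fin] ad_linear[OF \<mu>])
  ultimately have "\<theta> = Blinfun (ad \<mu> (abs_bivector (us @ ys))) o\<^sub>L f"
    by (intro blinfun_eqI) simp
  with D show ?thesis unfolding InnDer_def by blast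
qed

section \<open>The morphism equation near a given morphism\<close>

lemma delta1_trilinear:
  assumes \<pi>: "three_Lie_algebra \<pi>" and \<mu>: "three_Lie_algebra \<mu>"
  shows "trilinear (delta1 \<pi> \<mu> f \<theta>)"
  unfolding trilinear_def linear_iff delta1_def
  by (simp add: trilinear_simps[OF three_Lie_algebra_trilinear[OF \<pi>]]
      trilinear_simps[OF three_Lie_algebra_trilinear[OF \<mu>]]
      blinfun.add_right blinfun.scaleR_right algebra_simps)

text \<open>The linearization of the morphism equation at \<open>f\<close> is \<open>delta1\<close>; where it is injective,
  it dominates the quadratic and cubic remainder.\<close>

lemma morphism_isolated_where_delta1_injective:
  fixes \<pi> :: "'a::real_normed_vector \<Rightarrow> 'a \<Rightarrow> 'a \<Rightarrow> 'a"
    and \<mu> :: "'b::real_normed_vector \<Rightarrow> 'b \<Rightarrow> 'b \<Rightarrow> 'b"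
  assumes fina: "finite_dimensional (UNIV :: 'a set)" and finb: "finite_dimensional (UNIV :: 'b set)"
    and \<pi>: "three_Lie_algebra \<pi>" and \<mu>: "three_Lie_algebra \<mu>" and f: "three_Lie_morphism \<pi> \<mu> f"
    and C: "finite_dimensional C" "\<And>c. c \<in> C \<Longrightarrow> c \<in> Z1 \<pi> \<mu> f \<Longrightarrow> c = 0"
  obtains r where "r > 0"
    "\<And>c. c \<in> C \<Longrightarrow> norm c < r \<Longrightarrow> three_Lie_morphism \<pi> \<mu> (f + c) \<Longrightarrow> c = 0"
proof -
  note \<mu>_simps = trilinear_simps[OF three_Lie_algebra_trilinear[OF \<mu>]]
  note T_apply = trilinear_blinfun_apply[OF fina delta1_trilinear[OF \<pi> \<mu>]]
  define T where "T \<theta> = trilinear_blinfun (delta1 \<pi> \<mu> f \<theta>)" for \<theta>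
  have "linear T"
    unfolding T_def
    by (intro linearI blinfun_eqI)
      (simp_all add: T_apply blinfun.add_left blinfun.scaleR_left delta1_def \<mu>_simps algebra_simps)
  moreover have "\<theta> = 0" if "\<theta> \<in> C" "T \<theta> = 0" for \<theta>
  proof -
    have "delta1 \<pi> \<mu> f \<theta> x y z = 0" for x y z
      using T_apply[of f \<theta> x y z] that(2) by (simp add: T_def)
    with that(1) C(2) show ?thesis by (simp add: Z1_def)
  qed
  ultimately obtain a where "a > 0" and a: "\<And>c. c \<in> C \<Longrightarrow> a * norm c \<le> norm (T c)"
    using finite_dimensional_bounded_below[OF C(1)] by metis
  obtain K where "K > 0" and K: "\<And>x y z. norm (\<mu> x y z) \<le> K * norm x * norm y * norm z"
    using trilinear_bounded[OF finb three_Lie_algebra_trilinear[OF \<mu>]] by metis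
  \<comment> \<open>The remainder has three quadratic terms with one factor \<open>f\<close> and one
    cubic term. For \<open>norm c < 1\<close> the cubic one counts as quadratic, so the total is at
    most \<open>N * norm c ^ 2\<close>. The radius \<open>a / N\<close> is where this falls below
    the lower bound \<open>a * norm c\<close>.\<close>
  define N where "N = K * (3 * norm f + 1)"
  have "N > 0" using \<open>K > 0\<close> by (simp add: N_def add_nonneg_pos)
  have "c = 0" if c: "c \<in> C" "norm c < min 1 (a / N)" "three_Lie_morphism \<pi> \<mu> (f + c)" for c
  proof -
    let ?f = "blinfun_apply f" and ?c = "blinfun_apply c"
    have bound: "norm (\<mu> (blinfun_apply g x) (blinfun_apply h y) (blinfun_apply k z))
        \<le> K * (norm g * norm h * norm k) * norm x * norm y * norm z" for g h k :: "'a \<Rightarrow>\<^sub>L 'b" and x y z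
    proof -
      have "norm (\<mu> (blinfun_apply g x) (blinfun_apply h y) (blinfun_apply k z)) \<le>
          K * norm (blinfun_apply g x) * norm (blinfun_apply h y) * norm (blinfun_apply k z)"
        by (rule K)
      also have "\<dots> \<le> K * (norm g * norm x) * (norm h * norm y) * (norm k * norm z)"
        using \<open>K > 0\<close> by (intro mult_mono norm_blinfun) auto
      finally show ?thesis by (simp add: algebra_simps)
    qed
    have Q: "delta1 \<pi> \<mu> f c x y z = - (\<mu> (?c x) (?c y) (?f z) + \<mu> (?c x) (?f y) (?c z) +
        \<mu> (?f x) (?c y) (?c z) + \<mu> (?c x) (?c y) (?c z))" for x y z
    proof -
      have "?f (\<pi> x y z) + ?c (\<pi> x y z) = \<mu> (?f x + ?c x) (?f y + ?c y) (?f z + ?c z)"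
        using c(3) by (simp add: three_Lie_morphism_def blinfun.add_left)
      moreover have "?f (\<pi> x y z) = \<mu> (?f x) (?f y) (?f z)"
        using f by (simp add: three_Lie_morphism_def)
      ultimately show ?thesis by (simp add: delta1_def \<mu>_simps algebra_simps)
    qed
    have "norm (T c) \<le> N * norm c ^ 2"
      unfolding T_def
    proof (rule norm_trilinear_blinfun_le[OF fina delta1_trilinear[OF \<pi> \<mu>]])
      fix x y z
      have "norm (delta1 \<pi> \<mu> f c x y z) \<le> norm (\<mu> (?c x) (?c y) (?f z)) + norm (\<mu> (?c x) (?f y) (?c z)) +
          norm (\<mu> (?f x) (?c y) (?c z)) + norm (\<mu> (?c x) (?c y) (?c z))"
        unfolding Q norm_minus_cancel by (intro norm_triangle_le add_right_mono order.refl)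
      also have "\<dots> \<le> K * (norm c * norm c * norm f) * norm x * norm y * norm z +
          K * (norm c * norm f * norm c) * norm x * norm y * norm z +
          K * (norm f * norm c * norm c) * norm x * norm y * norm z +
          K * (norm c * norm c * norm c) * norm x * norm y * norm z"
        by (intro add_mono bound)
      also have "\<dots> = K * (3 * norm f + norm c) * norm c ^ 2 * norm x * norm y * norm z"
        by (simp add: algebra_simps power2_eq_square)
      also have "\<dots> \<le> N * norm c ^ 2 * norm x * norm y * norm z"
        unfolding N_def using c(2) \<open>K > 0\<close> by (intro mult_right_mono mult_left_mono) auto
      finally show "norm (delta1 \<pi> \<mu> f c x y z) \<le> N * norm c ^ 2 * norm x * norm y * norm z" .
    qed (use \<open>N > 0\<close> in simp)
    with a[OF c(1)] have "a * norm c \<le> N * norm c * norm c"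
      by (simp add: power2_eq_square)
    moreover have "N * norm c < a" using c(2) \<open>N > 0\<close> by (simp add: field_simps)
    ultimately have "\<not> norm c > 0" by (smt (verit) mult_less_cancel_right)
    then show ?thesis by simp
  qed
  with \<open>a > 0\<close> \<open>N > 0\<close> that[of "min 1 (a / N)"] show thesis by simp
qed

text \<open>Since \<open>0\<close> lies in \<open>B1\<close>, a cocycle belongs to its own coset,
  and vanishing of \<open>H1\<close> identifies that coset with \<open>B1\<close>.\<close>

lemma Z1_subset_B1:
  assumes "three_Lie_algebra \<pi>" "three_Lie_algebra \<mu>" and "H1 \<pi> \<mu> f = {B1 \<pi> \<mu> f}"
  shows "Z1 \<pi> \<mu> f \<subseteq> B1 \<pi> \<mu> f"
proof
  fix \<theta> assume "\<theta> \<in> Z1 \<pi> \<mu> f"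
  then have "(+) \<theta> ` B1 \<pi> \<mu> f = B1 \<pi> \<mu> f" using assms(3) unfolding H1_def by blast
  then show "\<theta> \<in> B1 \<pi> \<mu> f" using zero_in_B1[OF assms(1,2), of f] by force
qed

section \<open>Automorphisms from integrated inner derivations\<close>

text \<open>Expand in \<open>E = D + R\<close>. The order-zero terms cancel, and so do the linear
  terms in \<open>D\<close>, as \<open>D\<close> is a derivation. What survives is four terms linear
  in \<open>R\<close> (three slots and \<open>R (\<mu> x y z)\<close>) and four with at least two
  factors \<open>E\<close>, whence the constant 4; \<open>norm E \<le> 1\<close> reduces the cubic
  term to a quadratic one.\<close>

lemma near_derivation_bound:
  fixes \<mu> :: "'b::real_normed_vector \<Rightarrow> 'b \<Rightarrow> 'b \<Rightarrow> 'b" and D R :: "'b \<Rightarrow>\<^sub>L 'b"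
  assumes \<mu>: "trilinear \<mu>"
    and K: "K \<ge> 0" "\<And>x y z. norm (\<mu> x y z) \<le> K * norm x * norm y * norm z"
    and D: "\<And>x y z. blinfun_apply D (\<mu> x y z) =
      \<mu> (blinfun_apply D x) y z + \<mu> x (blinfun_apply D y) z + \<mu> x y (blinfun_apply D z)"
    and H: "H = id_blinfun + (D + R)" and small: "norm (D + R) \<le> 1"
  shows "norm (\<mu> (blinfun_apply H x) (blinfun_apply H y) (blinfun_apply H z) - blinfun_apply H (\<mu> x y z))
    \<le> 4 * K * (norm R + (norm (D + R))\<^sup>2) * (norm x * norm y * norm z)"
proof -
  define E where "E = D + R"
  define P where "P = norm x * norm y * norm z"
  have bound: "norm (\<mu> (blinfun_apply A x) (blinfun_apply B y) (blinfun_apply C z))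
      \<le> K * (norm A * norm B * norm C) * P" for A B C :: "'b \<Rightarrow>\<^sub>L 'b"
  proof -
    have "norm (\<mu> (blinfun_apply A x) (blinfun_apply B y) (blinfun_apply C z)) \<le>
        K * norm (blinfun_apply A x) * norm (blinfun_apply B y) * norm (blinfun_apply C z)"
      by (rule K)
    also have "\<dots> \<le> K * (norm A * norm x) * (norm B * norm y) * (norm C * norm z)"
      using \<open>K \<ge> 0\<close> by (intro mult_mono norm_blinfun) auto
    finally show ?thesis by (simp add: P_def algebra_simps)
  qed
  \<comment> \<open>Only an inequality: on the zero space the identity has norm 0.\<close>
  have id_le: "norm (id_blinfun :: 'b \<Rightarrow>\<^sub>L 'b) \<le> 1" by (rule norm_blinfun_id_le)
  have le: "norm A * norm B * norm C \<le> s"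
    if "norm A \<le> a" "norm B \<le> b" "norm C \<le> c" "a * b * c \<le> s" for A B C :: "'b \<Rightarrow>\<^sub>L 'b" and a b c s
  proof -
    have "norm A * norm B * norm C \<le> a * b * c"
      using that by (intro mult_mono) (auto intro: order_trans[OF norm_ge_zero] mult_nonneg_nonneg)
    then show ?thesis using that(4) by linarith
  qed
  have bound': "norm (\<mu> (blinfun_apply A x) (blinfun_apply B y) (blinfun_apply C z)) \<le> K * s * P"
    if "norm A * norm B * norm C \<le> s" for A B C :: "'b \<Rightarrow>\<^sub>L 'b" and s
  proof -
    have "K * (norm A * norm B * norm C) * P \<le> K * s * P"
      using that \<open>K \<ge> 0\<close> by (intro mult_right_mono mult_left_mono) (auto simp: P_def)
    then show ?thesis using bound[of A B C] by linarith
  qed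
  let ?i = "id_blinfun :: 'b \<Rightarrow>\<^sub>L 'b"
  define L where "L = \<mu> (blinfun_apply R x) (blinfun_apply ?i y) (blinfun_apply ?i z)
      + \<mu> (blinfun_apply ?i x) (blinfun_apply R y) (blinfun_apply ?i z)
      + \<mu> (blinfun_apply ?i x) (blinfun_apply ?i y) (blinfun_apply R z) - blinfun_apply R (\<mu> x y z)"
  define Q where "Q = \<mu> (blinfun_apply E x) (blinfun_apply E y) (blinfun_apply ?i z)
      + \<mu> (blinfun_apply E x) (blinfun_apply ?i y) (blinfun_apply E z)
      + \<mu> (blinfun_apply ?i x) (blinfun_apply E y) (blinfun_apply E z)
      + \<mu> (blinfun_apply E x) (blinfun_apply E y) (blinfun_apply E z)"
  have split: "\<mu> (blinfun_apply H x) (blinfun_apply H y) (blinfun_apply H z) - blinfun_apply H (\<mu> x y z) = L + Q"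
    unfolding L_def Q_def E_def H by (simp add: blinfun.add_left trilinear_simps[OF \<mu>] D)
  have R: "norm (blinfun_apply R (\<mu> x y z)) \<le> K * norm R * P"
  proof -
    have "norm (blinfun_apply R (\<mu> x y z)) \<le> norm R * norm (\<mu> x y z)" by (rule norm_blinfun)
    also have "\<dots> \<le> norm R * (K * norm x * norm y * norm z)" by (intro mult_left_mono K) simp
    finally show ?thesis by (simp add: P_def algebra_simps)
  qed
  have "norm L \<le> K * norm R * P + K * norm R * P + K * norm R * P + K * norm R * P"
    unfolding L_def
    by (intro norm_triangle_le_diff norm_triangle_le add_mono R bound' le[OF order.refl id_le id_le]
        le[OF id_le order.refl id_le] le[OF id_le id_le order.refl]) simp_all
  moreover have "norm Q \<le> K * (norm E)\<^sup>2 * P + K * (norm E)\<^sup>2 * P + K * (norm E)\<^sup>2 * P + K * (norm E)\<^sup>2 * P"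
    unfolding Q_def
    using small[folded E_def]
    by (intro norm_triangle_le add_mono bound' le[OF order.refl order.refl id_le]
        le[OF order.refl id_le order.refl] le[OF id_le order.refl order.refl]
        le[OF order.refl order.refl small[folded E_def]]) (simp_all add: power2_eq_square)
  moreover have "norm (L + Q) \<le> norm L + norm Q" by (rule norm_triangle_ineq)
  ultimately show ?thesis
    unfolding split E_def[symmetric] P_def[symmetric] by (simp add: algebra_simps)
qed

text \<open>Fixes one chart at the identity, in which the differential \<open>l\<close> of
  \<open>\<rho>\<close> is read. Its image makes every \<open>l v\<close> a derivation, and its
  injectivity on the model space is what \<open>l_bounded_below\<close> quantifies.\<close>

locale integrated_inner_derivations =
  fixes \<mu> :: "'b::real_normed_vector \<Rightarrow> 'b \<Rightarrow> 'b \<Rightarrow> 'b"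
    and G :: "'g monoid" and M :: "('g, 'e::real_normed_vector) manifold"
    and \<rho> :: "'g \<Rightarrow> ('b \<Rightarrow>\<^sub>L 'b)"
    and U :: "'g set" and \<phi> :: "'g \<Rightarrow> 'e" and l :: "'e \<Rightarrow> ('b \<Rightarrow>\<^sub>L 'b)"
  assumes finite_dim: "finite_dimensional (UNIV :: 'b set)"
    and three_Lie: "three_Lie_algebra \<mu>"
    and Lie_group: "Lie_group G M"
    and hom: "\<rho> \<in> hom G general_linear_group"
    and smooth: "smooth_map M (open_submanifold (carrier general_linear_group)) \<rho>"
    and atlas: "(U, \<phi>) \<in> atlas M" and one_in_U: "\<one>\<^bsub>G\<^esub> \<in> U"
    and derivative_at_one: "((\<rho> \<circ> inv_into U \<phi>) has_derivative l) (at (\<phi> \<one>\<^bsub>G\<^esub>) within model M)"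
    and bij_InnDer: "bij_betw l (model M) (InnDer \<mu>)"
begin

lemma group: "group G" and topspace: "topspace (mtop M) = carrier G"
  and manifold: "smooth_manifold M"
  and continuous_mult: "continuous_map (prod_topology (mtop M) (mtop M)) (mtop M) (\<lambda>(x, y). x \<otimes>\<^bsub>G\<^esub> y)"
  using Lie_group by (auto simp: Lie_group_def smooth_map_def prod_manifold_def)

sublocale group G by (rule group)

lemma \<rho>_mult: "x \<in> carrier G \<Longrightarrow> y \<in> carrier G \<Longrightarrow> \<rho> (x \<otimes>\<^bsub>G\<^esub> y) = \<rho> x o\<^sub>L \<rho> y"
  using hom by (simp add: hom_def general_linear_group_def)

lemma \<rho>_GL: "x \<in> carrier G \<Longrightarrow> \<rho> x \<in> carrier general_linear_group"
  using hom by (auto simp: hom_def)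

text \<open>\<open>\<rho> \<one>\<close> is idempotent and has a right inverse, which forces it to
  be the identity.\<close>

lemma \<rho>_one: "\<rho> \<one>\<^bsub>G\<^esub> = id_blinfun"
proof -
  obtain B where "\<rho> \<one>\<^bsub>G\<^esub> o\<^sub>L B = id_blinfun"
    using \<rho>_GL[OF one_closed] by (auto simp: general_linear_group_def)
  then have B: "blinfun_apply (\<rho> \<one>\<^bsub>G\<^esub>) (blinfun_apply B v) = v" for v
    by (metis blinfun_apply_blinfun_compose blinfun_apply_id_blinfun id_apply)
  have "\<rho> \<one>\<^bsub>G\<^esub> o\<^sub>L \<rho> \<one>\<^bsub>G\<^esub> = \<rho> \<one>\<^bsub>G\<^esub>" using \<rho>_mult[of "\<one>\<^bsub>G\<^esub>" "\<one>\<^bsub>G\<^esub>"] by simp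
  then have "blinfun_apply (\<rho> \<one>\<^bsub>G\<^esub>) v = v" for v
    by (metis B blinfun_apply_blinfun_compose)
  then show ?thesis by (intro blinfun_eqI) simp
qed

lemma \<rho>_inv_apply:
  assumes "x \<in> carrier G"
  shows "blinfun_apply (\<rho> x) (blinfun_apply (\<rho> (inv\<^bsub>G\<^esub> x)) v) = v"
    and "blinfun_apply (\<rho> (inv\<^bsub>G\<^esub> x)) (blinfun_apply (\<rho> x) v) = v"
  using \<rho>_mult[of x "inv\<^bsub>G\<^esub> x"] \<rho>_mult[of "inv\<^bsub>G\<^esub> x" x] assms
  by (simp_all add: \<rho>_one flip: blinfun_apply_blinfun_compose)

lemma continuous_\<rho>: "continuous_map (mtop M) euclidean \<rho>"
  using smooth by (auto simp: smooth_map_def open_submanifold_def continuous_map_in_subtopology)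

lemma chart: "openin (mtop M) U" "openin (top_of_set (model M)) (\<phi> ` U)"
  "homeomorphic_map (subtopology (mtop M) U) (top_of_set (\<phi> ` U)) \<phi>"
  using manifold atlas by (auto simp: smooth_manifold_def chart_def)

lemma U_subset: "U \<subseteq> carrier G"
  using openin_subset[OF chart(1)] topspace by simp

lemma inj_\<phi>: "inj_on \<phi> U"
  using homeomorphic_imp_injective_map[OF chart(3)] U_subset topspace
  by (simp add: Int_absorb1)

lemma continuous_\<phi>: "continuous_map (subtopology (mtop M) U) euclidean \<phi>"
  using homeomorphic_imp_continuous_map[OF chart(3)] by (simp add: continuous_map_in_subtopology)

lemma continuous_inv_\<phi>: "continuous_map (top_of_set (\<phi> ` U)) (mtop M) (inv_into U \<phi>)"
proof -
  obtain g where g: "homeomorphic_maps (subtopology (mtop M) U) (top_of_set (\<phi> ` U)) \<phi> g"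
    using chart(3) by (auto simp: homeomorphic_map_maps)
  have "g y = inv_into U \<phi> y" if y: "y \<in> \<phi> ` U" for y
  proof -
    obtain x where "x \<in> U" "y = \<phi> x" using y by blast
    moreover have "g (\<phi> x) = x"
      using g \<open>x \<in> U\<close> U_subset topspace unfolding homeomorphic_maps_def by auto
    ultimately show ?thesis using inj_\<phi> by simp
  qed
  then have "continuous_map (top_of_set (\<phi> ` U)) (subtopology (mtop M) U) (inv_into U \<phi>)"
    using g unfolding homeomorphic_maps_def by (elim conjE continuous_map_eq) simp
  then show ?thesis by (simp add: continuous_map_in_subtopology)
qed

lemma linear_l: "bounded_linear l"
  using derivative_at_one by (rule has_derivative_bounded_linear)

lemma fin_model: "finite_dimensional (model M)"
  using manifold by (simp add: smooth_manifold_def)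

lemma \<phi>_one_in_model: "\<phi> \<one>\<^bsub>G\<^esub> \<in> model M"
  using openin_subset[OF chart(2)] one_in_U by auto

text \<open>Differentiability gives an error small relative to the chart displacement
  \<open>v\<close>; this bound makes it small relative to \<open>\<rho> h - id_blinfun\<close>,
  which is \<open>l v\<close> plus that error.\<close>

lemma l_bounded_below:
  obtains a where "a > 0" "\<And>v. v \<in> model M \<Longrightarrow> a * norm v \<le> norm (l v)"
proof (rule finite_dimensional_bounded_below[OF fin_model bounded_linear.linear[OF linear_l]])
  have "0 \<in> model M" using finite_dimensional_subspace[OF fin_model] by (rule subspace_0)
  then show "v = 0" if "v \<in> model M" "l v = 0" for v
    using bij_InnDer that linear_0[OF bounded_linear.linear[OF linear_l]]
    by (metis bij_betw_imp_inj_on inj_onD)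
qed (use that in blast)

text \<open>The first-order part of \<open>\<rho> h - 1\<close> is a derivation, so \<open>\<rho> h\<close> fails to be an automorphism
  only by \<open>o(\<rho> h - 1)\<close>.\<close>

lemma automorphism_to_first_order:
  assumes "\<eta> > 0"
  obtains N where "openin (mtop M) N" "\<one>\<^bsub>G\<^esub> \<in> N" "\<And>h. h \<in> N \<Longrightarrow> norm (\<rho> h - id_blinfun) \<le> 1 / 2"
    "\<And>h x y z. h \<in> N \<Longrightarrow>
      norm (\<mu> (blinfun_apply (\<rho> h) x) (blinfun_apply (\<rho> h) y) (blinfun_apply (\<rho> h) z)
        - blinfun_apply (\<rho> h) (\<mu> x y z))
      \<le> \<eta> * norm (\<rho> h - id_blinfun) * (norm x * norm y * norm z)"
proof -
  note trilinear = three_Lie_algebra_trilinear[OF three_Lie]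
  obtain K where "K > 0" and K: "\<And>x y z. norm (\<mu> x y z) \<le> K * norm x * norm y * norm z"
    using trilinear_bounded[OF finite_dim trilinear] by metis
  obtain a where "a > 0" and a: "\<And>v. v \<in> model M \<Longrightarrow> a * norm v \<le> norm (l v)"
    using l_bounded_below by blast
  \<comment> \<open>The entry \<open>a / 2\<close> lets \<open>l v\<close> dominate the remainder,
    giving \<open>a / 2 * norm v \<le> norm (\<rho> h - id_blinfun)\<close>. The other entry then
    yields \<open>norm R \<le> \<eta> / (8 * K) * norm (\<rho> h - id_blinfun)\<close>.\<close>
  define e where "e = min (a / 2) (\<eta> * a / (16 * K))"
  have "e > 0" using \<open>a > 0\<close> \<open>K > 0\<close> \<open>\<eta> > 0\<close> by (simp add: e_def)
  \<comment> \<open>\<open>\<eta> / (8 * K)\<close> contributes as much from the squared norm as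
    \<open>R\<close> does; together they make \<open>\<eta> / (4 * K)\<close>, which cancels the
    factor \<open>4 * K\<close> of \<open>near_derivation_bound\<close>. The entry 1/2 later bounds
    the inverse of \<open>\<rho> h\<close> by 2.\<close>
  define \<delta> where "\<delta> = min (1 / 2) (\<eta> / (8 * K))"
  have "\<delta> > 0" using \<open>K > 0\<close> \<open>\<eta> > 0\<close> by (simp add: \<delta>_def)
  obtain d where "d > 0" and d: "\<And>y. y \<in> model M \<Longrightarrow> norm (y - \<phi> \<one>\<^bsub>G\<^esub>) < d \<Longrightarrow>
      norm ((\<rho> \<circ> inv_into U \<phi>) y - (\<rho> \<circ> inv_into U \<phi>) (\<phi> \<one>\<^bsub>G\<^esub>) - l (y - \<phi> \<one>\<^bsub>G\<^esub>)) \<le> e * norm (y - \<phi> \<one>\<^bsub>G\<^esub>)"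
    using derivative_at_one \<open>e > 0\<close> unfolding has_derivative_within_alt by blast
  define N where "N = {h \<in> topspace (subtopology (mtop M) U). \<phi> h \<in> ball (\<phi> \<one>\<^bsub>G\<^esub>) d} \<inter>
      {h \<in> topspace (mtop M). \<rho> h \<in> ball id_blinfun \<delta>}"
  have "openin (mtop M) N"
    unfolding N_def
    by (intro openin_Int openin_continuous_map_preimage[OF continuous_\<rho>]
        openin_trans_full[OF openin_continuous_map_preimage[OF continuous_\<phi>] chart(1)]) auto
  moreover have "\<one>\<^bsub>G\<^esub> \<in> N"
    using one_in_U \<open>d > 0\<close> \<open>\<delta> > 0\<close> by (simp add: N_def topspace \<rho>_one)
  moreover have "norm (\<rho> h - id_blinfun) \<le> 1 / 2" if "h \<in> N" for h
    using that by (simp add: N_def \<delta>_def dist_norm norm_minus_commute)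
  moreover have "norm (\<mu> (blinfun_apply (\<rho> h) x) (blinfun_apply (\<rho> h) y) (blinfun_apply (\<rho> h) z)
        - blinfun_apply (\<rho> h) (\<mu> x y z))
      \<le> \<eta> * norm (\<rho> h - id_blinfun) * (norm x * norm y * norm z)" if h: "h \<in> N" for h x y z
  proof -
    have "h \<in> U" and hd: "norm (\<phi> h - \<phi> \<one>\<^bsub>G\<^esub>) < d" and h\<delta>: "norm (\<rho> h - id_blinfun) < \<delta>"
      using h by (auto simp: N_def dist_norm norm_minus_commute)
    define v where "v = \<phi> h - \<phi> \<one>\<^bsub>G\<^esub>"
    have "\<phi> h \<in> model M" using \<open>h \<in> U\<close> openin_subset[OF chart(2)] by auto
    then have "v \<in> model M"
      unfolding v_def using \<phi>_one_in_model finite_dimensional_subspace[OF fin_model]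
      by (intro subspace_diff)
    define R where "R = \<rho> h - id_blinfun - l v"
    have R: "norm R \<le> e * norm v"
      using d[OF \<open>\<phi> h \<in> model M\<close> hd] inj_\<phi> \<open>h \<in> U\<close> one_in_U by (simp add: R_def v_def \<rho>_one)
    have lR: "l v + R = \<rho> h - id_blinfun" by (simp add: R_def)
    have "a * norm v \<le> norm (l v + R) + norm R"
      using a[OF \<open>v \<in> model M\<close>] norm_triangle_ineq4[of "l v + R" R] by simp
    moreover have "e * norm v \<le> a / 2 * norm v" by (intro mult_right_mono) (auto simp: e_def)
    ultimately have "a / 2 * norm v \<le> norm (l v + R)" using R by (simp add: field_simps)
    then have "norm v \<le> 2 / a * norm (l v + R)" using \<open>a > 0\<close> by (simp add: field_simps)
    then have "e * norm v \<le> e * (2 / a * norm (l v + R))"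
      using \<open>e > 0\<close> by (intro mult_left_mono) auto
    also have "\<dots> \<le> (\<eta> * a / (16 * K)) * (2 / a * norm (l v + R))"
      using \<open>a > 0\<close> by (intro mult_right_mono) (auto simp: e_def)
    also have "\<dots> = \<eta> / (8 * K) * norm (l v + R)" using \<open>a > 0\<close> by simp
    finally have R': "norm R \<le> \<eta> / (8 * K) * norm (l v + R)" using R by linarith
    have "norm (l v + R) * norm (l v + R) \<le> \<eta> / (8 * K) * norm (l v + R)"
      using h\<delta> by (intro mult_right_mono) (auto simp: lR \<delta>_def)
    with R' have "norm R + (norm (l v + R))\<^sup>2 \<le> \<eta> / (4 * K) * norm (l v + R)"
      by (simp add: power2_eq_square field_simps)
    then have "4 * K * (norm R + (norm (l v + R))\<^sup>2) \<le> 4 * K * (\<eta> / (4 * K) * norm (l v + R))"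
      using \<open>K > 0\<close> by (intro mult_left_mono) auto
    also have "\<dots> = \<eta> * norm (l v + R)" using \<open>K > 0\<close> by simp
    finally have "4 * K * (norm R + (norm (l v + R))\<^sup>2) \<le> \<eta> * norm (l v + R)" .
    moreover have "norm (\<mu> (blinfun_apply (\<rho> h) x) (blinfun_apply (\<rho> h) y) (blinfun_apply (\<rho> h) z)
        - blinfun_apply (\<rho> h) (\<mu> x y z))
        \<le> 4 * K * (norm R + (norm (l v + R))\<^sup>2) * (norm x * norm y * norm z)"
    proof (rule near_derivation_bound[OF trilinear less_imp_le[OF \<open>K > 0\<close>] K])
      have "l v \<in> InnDer \<mu>" using bij_InnDer \<open>v \<in> model M\<close> by (auto simp: bij_betw_def)
      then show "blinfun_apply (l v) (\<mu> x y z) =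
        \<mu> (blinfun_apply (l v) x) y z + \<mu> x (blinfun_apply (l v) y) z + \<mu> x y (blinfun_apply (l v) z)"
        for x y z by (rule InnDer_derivation[OF three_Lie])
      show "\<rho> h = id_blinfun + (l v + R)" by (simp add: R_def)
      show "norm (l v + R) \<le> 1" using h\<delta> by (simp add: lR \<delta>_def)
    qed
    ultimately show ?thesis
      unfolding lR[symmetric]
      by (meson mult_nonneg_nonneg mult_right_mono norm_ge_zero order_trans)
  qed
  ultimately show thesis using that by blast
qed

text \<open>With \<open>A w = \<rho> (\<gamma> w)\<close>, the structure \<open>A\<^sup>-\<^sup>1 \<mu> (A x, A y, A z)\<close> has zero derivative in \<open>w\<close>:
  compare \<open>w\<close> with \<open>w0\<close> through \<open>h = \<gamma> w (\<gamma> w0)\<^sup>-\<^sup>1\<close>, which is close to the identity.\<close>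

lemma automorphism_along:
  fixes \<gamma> :: "'w::real_normed_vector \<Rightarrow> 'g"
  assumes S: "open S" "convex S"
    and \<gamma>: "continuous_map (top_of_set S) (mtop M) \<gamma>"
    and der: "\<And>w. w \<in> S \<Longrightarrow> ((\<lambda>w. \<rho> (\<gamma> w)) has_derivative A' w) (at w)"
    and u: "u \<in> S" "\<gamma> u = \<one>\<^bsub>G\<^esub>" and w: "w \<in> S"
  shows "\<mu> (blinfun_apply (\<rho> (\<gamma> w)) x) (blinfun_apply (\<rho> (\<gamma> w)) y) (blinfun_apply (\<rho> (\<gamma> w)) z) =
    blinfun_apply (\<rho> (\<gamma> w)) (\<mu> x y z)"
proof -
  have \<gamma>_carrier: "\<gamma> w \<in> carrier G" if "w \<in> S" for w
    using continuous_map_image_subset_topspace[OF \<gamma>] that topspace by auto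
  define A where "A w = blinfun_apply (\<rho> (\<gamma> w))" for w
  define F where "F w = blinfun_apply (\<rho> (inv\<^bsub>G\<^esub> (\<gamma> w))) (\<mu> (A w x) (A w y) (A w z))" for w
  have "(F has_derivative (\<lambda>_. 0)) (at v within S)" if v: "v \<in> S" for v
    unfolding has_derivative_within_alt
  proof (intro conjI allI impI)
    fix e :: real assume "e > 0"
    define B where "B = \<rho> (inv\<^bsub>G\<^esub> (\<gamma> v))"
    define P where "P = norm (A v x) * norm (A v y) * norm (A v z)"
    obtain C d1 where "C > 0" "d1 > 0"
      and C: "\<And>w. norm (w - v) < d1 \<Longrightarrow> norm (\<rho> (\<gamma> w) - \<rho> (\<gamma> v)) \<le> C * norm (w - v)"
    proof -
      obtain d where "d > 0" and d: "\<And>w. norm (w - v) < d \<Longrightarrow>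
          norm (\<rho> (\<gamma> w) - \<rho> (\<gamma> v) - A' v (w - v)) \<le> 1 * norm (w - v)"
        using der[OF v] unfolding has_derivative_within_alt by (metis UNIV_I zero_less_one)
      obtain K where "K > 0" and K: "\<And>h. norm (A' v h) \<le> norm h * K"
        using bounded_linear.pos_bounded[OF has_derivative_bounded_linear[OF der[OF v]]] by blast
      show thesis
      proof (rule that[of "1 + K" d])
        fix w assume "norm (w - v) < d"
        from d[OF this] K[of "w - v"]
          norm_triangle_ineq[of "\<rho> (\<gamma> w) - \<rho> (\<gamma> v) - A' v (w - v)" "A' v (w - v)"]
        show "norm (\<rho> (\<gamma> w) - \<rho> (\<gamma> v)) \<le> (1 + K) * norm (w - v)"
          by (simp add: algebra_simps)
      qed (use \<open>d > 0\<close> \<open>K > 0\<close> in auto)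
    qed
    \<comment> \<open>All factors of the final estimate other than \<open>\<eta>\<close> and
      \<open>norm (w - v)\<close>. The summand 1 in the denominator of \<open>\<eta>\<close> covers
      the case \<open>Q = 0\<close>.\<close>
    define Q where "Q = 2 * norm B * C * norm B * P"
    have "Q \<ge> 0" using \<open>C > 0\<close> by (simp add: Q_def P_def)
    define \<eta> where "\<eta> = e / (Q + 1)"
    have "\<eta> > 0" using \<open>e > 0\<close> \<open>Q \<ge> 0\<close> by (simp add: \<eta>_def)
    obtain N where N: "openin (mtop M) N" "\<one>\<^bsub>G\<^esub> \<in> N"
      "\<And>h. h \<in> N \<Longrightarrow> norm (\<rho> h - id_blinfun) \<le> 1 / 2"
      "\<And>h x y z. h \<in> N \<Longrightarrow>
        norm (\<mu> (blinfun_apply (\<rho> h) x) (blinfun_apply (\<rho> h) y) (blinfun_apply (\<rho> h) z)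
          - blinfun_apply (\<rho> h) (\<mu> x y z))
        \<le> \<eta> * norm (\<rho> h - id_blinfun) * (norm x * norm y * norm z)"
      using automorphism_to_first_order[OF \<open>\<eta> > 0\<close>] by blast
    define h where "h w = \<gamma> w \<otimes>\<^bsub>G\<^esub> inv\<^bsub>G\<^esub> (\<gamma> v)" for w
    have "continuous_map (top_of_set S) (mtop M) ((\<lambda>(x, y). x \<otimes>\<^bsub>G\<^esub> y) \<circ> (\<lambda>w. (\<gamma> w, inv\<^bsub>G\<^esub> (\<gamma> v))))"
      using \<gamma>_carrier[OF v] topspace
      by (intro continuous_map_compose[OF _ continuous_mult] continuous_map_pairedI \<gamma>) simp
    then have "continuous_map (top_of_set S) (mtop M) h" by (simp add: h_def[abs_def] o_def)
    then have "openin (top_of_set S) {w \<in> S. h w \<in> N}"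
      using openin_continuous_map_preimage[OF _ N(1)] by fastforce
    then have "open {w \<in> S. h w \<in> N}" using S(1) openin_open_trans open_openin openin_trans_full by blast
    moreover have "v \<in> {w \<in> S. h w \<in> N}" using v N(2) \<gamma>_carrier by (simp add: h_def)
    ultimately obtain d2 where "d2 > 0" and d2: "ball v d2 \<subseteq> {w \<in> S. h w \<in> N}"
      using open_contains_ball by blast
    show "\<exists>d>0. \<forall>w\<in>S. norm (w - v) < d \<longrightarrow> norm (F w - F v - 0) \<le> e * norm (w - v)"
    proof (intro exI[of _ "min d1 d2"] conjI ballI impI)
      fix w assume "w \<in> S" "norm (w - v) < min d1 d2"
      then have "norm (w - v) < d1" and hN: "h w \<in> N"
        using d2 by (auto simp: dist_norm norm_minus_commute)
      note carrier = \<gamma>_carrier[OF v] \<gamma>_carrier[OF \<open>w \<in> S\<close>]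
      have h_carrier: "h w \<in> carrier G" using carrier by (simp add: h_def)
      let ?H = "\<rho> (h w)"
      have \<gamma>w: "\<gamma> w = h w \<otimes>\<^bsub>G\<^esub> \<gamma> v" using carrier by (simp add: h_def m_assoc)
      have Aw: "A w t = blinfun_apply ?H (A v t)" for t
        unfolding A_def \<gamma>w using \<rho>_mult[OF h_carrier carrier(1)] by simp
      have inv: "blinfun_apply (\<rho> (inv\<^bsub>G\<^esub> (\<gamma> w))) t =
          blinfun_apply B (blinfun_apply (\<rho> (inv\<^bsub>G\<^esub> (h w))) t)" for t
        unfolding \<gamma>w B_def using carrier h_carrier by (simp add: inv_mult_group \<rho>_mult)
      \<comment> \<open>\<open>\<rho>\<close> of the inverse of \<open>\<gamma> w\<close> is
        \<open>B\<close> after \<open>\<rho>\<close> of the inverse of \<open>h w\<close>. Pulling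
        both terms through this product leaves the automorphism defect of
        \<open>\<rho> (h w)\<close> at the fixed vectors \<open>A v x\<close>, \<open>A v y\<close>,
        \<open>A v z\<close>.\<close>
      have "F w - F v = blinfun_apply B (blinfun_apply (\<rho> (inv\<^bsub>G\<^esub> (h w)))
          (\<mu> (A w x) (A w y) (A w z) - blinfun_apply ?H (\<mu> (A v x) (A v y) (A v z))))"
        unfolding F_def inv by (simp add: blinfun.diff_right \<rho>_inv_apply(2)[OF h_carrier] B_def)
      also have "norm \<dots> \<le> norm B * (2 * (\<eta> * norm (?H - id_blinfun) * P))"
      proof -
        have inv_le: "norm (blinfun_apply (\<rho> (inv\<^bsub>G\<^esub> (h w))) t) \<le> 2 * norm t" for t
        proof -
          define s where "s = blinfun_apply (\<rho> (inv\<^bsub>G\<^esub> (h w))) t"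
          have "t = s + blinfun_apply (?H - id_blinfun) s"
            by (simp add: s_def blinfun.diff_left \<rho>_inv_apply(1)[OF h_carrier])
          then have "norm s \<le> norm t + norm (blinfun_apply (?H - id_blinfun) s)"
            by (metis add_diff_cancel_right' norm_triangle_ineq4)
          also have "norm (blinfun_apply (?H - id_blinfun) s) \<le> 1 / 2 * norm s"
            by (rule order_trans[OF norm_blinfun]) (intro mult_right_mono N(3) hN norm_ge_zero)
          finally show ?thesis by (simp add: s_def)
        qed
        have "norm (\<mu> (A w x) (A w y) (A w z) - blinfun_apply ?H (\<mu> (A v x) (A v y) (A v z)))
            \<le> \<eta> * norm (?H - id_blinfun) * P"
          unfolding Aw P_def by (rule N(4)[OF hN])
        then show ?thesis
          by (intro order_trans[OF norm_blinfun] mult_left_mono order_trans[OF inv_le]) auto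
      qed
      also have "\<dots> \<le> norm B * (2 * (\<eta> * (C * norm (w - v) * norm B) * P))"
      proof -
        have "?H - id_blinfun = (\<rho> (\<gamma> w) - \<rho> (\<gamma> v)) o\<^sub>L B"
          by (intro blinfun_eqI)
            (simp add: \<gamma>w \<rho>_mult[OF h_carrier carrier(1)] B_def blinfun.diff_left
              \<rho>_inv_apply(1)[OF carrier(1)])
        then have "norm (?H - id_blinfun) \<le> norm (\<rho> (\<gamma> w) - \<rho> (\<gamma> v)) * norm B"
          by (simp add: norm_blinfun_compose)
        also have "\<dots> \<le> C * norm (w - v) * norm B"
          using C[OF \<open>norm (w - v) < d1\<close>] by (intro mult_right_mono) auto
        finally show ?thesis
          using \<open>\<eta> > 0\<close> by (intro mult_left_mono mult_right_mono) (auto simp: P_def)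
      qed
      also have "\<dots> = (\<eta> * Q) * norm (w - v)" by (simp add: Q_def algebra_simps)
      also have "\<dots> \<le> e * norm (w - v)"
        using \<open>e > 0\<close> \<open>Q \<ge> 0\<close> by (intro mult_right_mono) (auto simp: \<eta>_def field_simps)
      finally show "norm (F w - F v - 0) \<le> e * norm (w - v)" by simp
    qed (use \<open>d1 > 0\<close> \<open>d2 > 0\<close> in auto)
  qed simp
  then have "F w = F u" using has_derivative_zero_unique[OF S(2) _ w u(1)] by blast
  then have "blinfun_apply (\<rho> (inv\<^bsub>G\<^esub> (\<gamma> w))) (\<mu> (A w x) (A w y) (A w z)) = \<mu> x y z"
    by (simp add: F_def A_def u(2) \<rho>_one)
  then show ?thesis using \<rho>_inv_apply(1)[OF \<gamma>_carrier[OF w]] unfolding A_def by metis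
qed

end

section \<open>Construction of the smooth family of inner automorphisms\<close>

theorem theorem4p8:
  fixes \<pi> :: "'a::real_normed_vector \<Rightarrow> 'a \<Rightarrow> 'a \<Rightarrow> 'a"
    and \<mu> :: "'b::real_normed_vector \<Rightarrow> 'b \<Rightarrow> 'b \<Rightarrow> 'b"
    and f :: "'a \<Rightarrow>\<^sub>L 'b"
    and InnAut :: "'g monoid"
    and M :: "('g, 'e::real_normed_vector) manifold"
    and \<rho> :: "'g \<Rightarrow> ('b \<Rightarrow>\<^sub>L 'b)"
  assumes "finite_dimensional (UNIV :: 'a set)"
    and "finite_dimensional (UNIV :: 'b set)"
    and "three_Lie_algebra \<pi>"
    and "three_Lie_algebra \<mu>"
    and "three_Lie_morphism \<pi> \<mu> f"
    and "is_InnAut \<mu> InnAut M \<rho>"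
    and "H1 \<pi> \<mu> f = {B1 \<pi> \<mu> f}"
  shows "\<exists>U p. open U \<and> f \<in> U \<and> smooth_map (open_submanifold U) M p \<and>
    (\<forall>f'\<in>U. three_Lie_morphism \<pi> \<mu> f' \<longrightarrow> \<rho> (p f') o\<^sub>L f = f')"
proof -
  have Lie_group: "Lie_group InnAut M" and integrates: "integrates_inclusion InnAut M \<rho> (InnDer \<mu>)"
    using assms(6) by (simp_all only: is_InnAut_def)
  have hom: "\<rho> \<in> hom InnAut general_linear_group"
    and smooth_\<rho>: "smooth_map M (open_submanifold (carrier general_linear_group)) \<rho>"
    using integrates by (simp_all only: integrates_inclusion_def)
  obtain U0 \<phi> l where at_one: "(U0, \<phi>) \<in> atlas M" "\<one>\<^bsub>InnAut\<^esub> \<in> U0"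
    "((\<rho> \<circ> inv_into U0 \<phi>) has_derivative l) (at (\<phi> \<one>\<^bsub>InnAut\<^esub>) within model M)"
    "bij_betw l (model M) (InnDer \<mu>)"
    using integrates unfolding integrates_inclusion_def
    by (elim conjE bexE exE) (simp only: split_paired_all prod.case, elim conjE exE, rule that)
  interpret integrated_inner_derivations \<mu> InnAut M \<rho> U0 \<phi> l
    using assms(2,4) Lie_group hom smooth_\<rho> at_one by (rule integrated_inner_derivations.intro)
  note finW = finite_dimensional_blinfun[OF assms(1,2)]
  define e where "e = \<phi> \<one>\<^bsub>InnAut\<^esub>"
  have sub: "subspace (model M)" using finite_dimensional_subspace[OF fin_model] .
  have \<phi>_inv: "inv_into U0 \<phi> (\<phi> x) = x" if "x \<in> U0" for x
    using inj_\<phi> that by simp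

  define orb where "orb v = l v o\<^sub>L f" for v
  have bl_orb: "bounded_linear orb"
    unfolding orb_def
    by (rule bounded_linear_compose[OF
        bounded_bilinear.bounded_linear_left[OF bounded_bilinear_blinfun_compose] linear_l])
  \<comment> \<open>\<open>orb\<close> may have a kernel, the infinitesimal stabilizer of
    \<open>f\<close>; \<open>\<sigma>\<close> merely chooses a linear lift of its image. Its values
    stay in the model space on all of \<open>Hom\<close>, also off that image.\<close>
  obtain \<sigma> where \<sigma>: "range \<sigma> \<subseteq> model M" "linear \<sigma>" "\<And>\<theta>. \<theta> \<in> orb ` model M \<Longrightarrow> orb (\<sigma> \<theta>) = \<theta>"
    using linear_exists_right_inverse_on[OF bounded_linear.linear[OF bl_orb] sub] by blast
  have bl_\<sigma>: "bounded_linear \<sigma>" using finite_dimensional_bounded_linear[OF finW \<sigma>(2)] .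
  define \<tau> where "\<tau> \<theta> = \<theta> - orb (\<sigma> \<theta>)" for \<theta>
  have bl_\<tau>: "bounded_linear \<tau>"
    unfolding \<tau>_def
    by (intro bounded_linear_sub bounded_linear_ident bounded_linear_compose[OF bl_orb bl_\<sigma>])
  have \<tau>_zero: "\<tau> \<theta> = 0" if "\<theta> \<in> orb ` model M" for \<theta>
    using \<sigma>(3)[OF that] by (simp add: \<tau>_def)
  have \<tau>_idem: "\<tau> (\<tau> \<theta>) = \<tau> \<theta>" for \<theta>
  proof -
    have "\<tau> (orb (\<sigma> \<theta>)) = 0" using \<sigma>(1) by (intro \<tau>_zero) blast
    moreover have "\<tau> (\<theta> - orb (\<sigma> \<theta>)) = \<tau> \<theta> - \<tau> (orb (\<sigma> \<theta>))"
      by (rule linear_diff[OF bounded_linear.linear[OF bl_\<tau>]])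
    ultimately show ?thesis by (simp add: \<tau>_def[of \<theta>, symmetric])
  qed
  have Z1: "\<theta> \<in> orb ` model M" if \<theta>: "\<theta> \<in> Z1 \<pi> \<mu> f" for \<theta>
  proof -
    obtain D where D: "D \<in> InnDer \<mu>" "\<theta> = D o\<^sub>L f"
      using B1_inner[OF assms(2-5) subsetD[OF Z1_subset_B1[OF assms(3,4,7)] \<theta>]] by (elim bexE)
    \<comment> \<open>Surjectivity of \<open>l\<close> enters here: every inner derivation is a
      tangent vector of the group.\<close>
    have "D \<in> l ` model M" using D(1) bij_betw_imp_surj_on[OF at_one(4)] by simp
    then show ?thesis unfolding D(2) orb_def by (elim imageE) simp
  qed
  obtain r where "r > 0" and r: "\<And>c. c \<in> range \<tau> \<Longrightarrow> norm c < r \<Longrightarrow>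
      three_Lie_morphism \<pi> \<mu> (f + c) \<Longrightarrow> c = 0"
  proof (rule morphism_isolated_where_delta1_injective[OF assms(1-5), of "range \<tau>"])
    show "finite_dimensional (range \<tau>)"
      by (rule finite_dimensional_range[OF finW bounded_linear.linear[OF bl_\<tau>]])
    show "c = 0" if "c \<in> range \<tau>" "c \<in> Z1 \<pi> \<mu> f" for c
      using that(1) \<tau>_zero[OF Z1[OF that(2)]] \<tau>_idem by force
  qed (rule that)

  define \<gamma> where "\<gamma> \<theta> = inv_into U0 \<phi> (e + \<sigma> \<theta>)" for \<theta>
  define S0 where "S0 = {\<theta>. e + \<sigma> \<theta> \<in> \<phi> ` U0}"
  have cont_\<sigma>: "continuous_on UNIV (\<lambda>\<theta>. e + \<sigma> \<theta>)"
    by (intro continuous_intros bounded_linear.continuous_on[OF bl_\<sigma>])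
  \<comment> \<open>The chart image is open only relative to \<open>model M\<close>. Since
    \<open>e + \<sigma> \<theta>\<close> never leaves the model space, its preimage is nevertheless
    open in \<open>Hom\<close>.\<close>
  have "open S0"
  proof -
    obtain O' where O': "open O'" "\<phi> ` U0 = model M \<inter> O'"
      using chart(2) by (auto simp: openin_open)
    have "e + \<sigma> \<theta> \<in> model M" for \<theta>
      using \<sigma>(1) \<phi>_one_in_model sub by (auto simp: e_def intro!: subspace_add)
    then have "S0 = (\<lambda>\<theta>. e + \<sigma> \<theta>) -` O'" by (auto simp: S0_def O'(2))
    then show ?thesis using open_vimage[OF O'(1) cont_\<sigma>] by simp
  qed
  have "open (\<tau> -` ball 0 r)"
    by (intro open_vimage open_ball bounded_linear.continuous_on[OF bl_\<tau>] continuous_on_id)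
  then have "open (S0 \<inter> \<tau> -` ball 0 r)" using \<open>open S0\<close> by blast
  moreover have zero: "\<sigma> 0 = 0" "\<tau> 0 = 0"
    using linear_0[OF \<sigma>(2)] linear_0[OF bounded_linear.linear[OF bl_\<tau>]] .
  moreover have "0 \<in> S0 \<inter> \<tau> -` ball 0 r"
    using at_one(2) \<open>r > 0\<close> by (simp add: S0_def zero e_def)
  ultimately obtain d where "d > 0" and d: "ball 0 d \<subseteq> S0 \<inter> \<tau> -` ball 0 r"
    using open_contains_ball by blast
  \<comment> \<open>A ball, hence convex as \<open>automorphism_along\<close> demands, and so small
    that \<open>\<tau> \<theta>\<close> stays within the isolation radius \<open>r\<close>.\<close>
  define S :: "('a \<Rightarrow>\<^sub>L 'b) set" where "S = ball 0 d"
  have S: "open S" "convex S" "0 \<in> S" "S \<subseteq> S0" "\<And>\<theta>. \<theta> \<in> S \<Longrightarrow> norm (\<tau> \<theta>) < r"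
    using \<open>d > 0\<close> d by (auto simp: S_def)
  have \<gamma>_U0: "\<gamma> \<theta> \<in> U0" "\<phi> (\<gamma> \<theta>) = e + \<sigma> \<theta>" if "\<theta> \<in> S" for \<theta>
    using that S(4) by (auto simp: \<gamma>_def S0_def inv_into_into f_inv_into_f)
  have \<gamma>_zero: "\<gamma> 0 = \<one>\<^bsub>InnAut\<^esub>" by (simp add: \<gamma>_def zero e_def \<phi>_inv at_one(2))
  have cont_\<gamma>: "continuous_map (top_of_set S) (mtop M) \<gamma>"
  proof -
    have "continuous_map (top_of_set S) (top_of_set (\<phi> ` U0)) (\<lambda>\<theta>. e + \<sigma> \<theta>)"
      using continuous_on_subset[OF cont_\<sigma>] S(4) by (auto simp: continuous_map_in_subtopology S0_def)
    from continuous_map_compose[OF this continuous_inv_\<phi>] show ?thesis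
      by (simp add: \<gamma>_def[abs_def] o_def)
  qed

  have smooth_R: "smooth_on S (\<lambda>\<theta>. \<rho> (\<gamma> \<theta>))"
  proof -
    have "{x \<in> U0. \<rho> x \<in> carrier general_linear_group} = U0" using \<rho>_GL U_subset by blast
    moreover have "smooth_on (\<phi> ` {x \<in> U0. \<rho> x \<in> carrier general_linear_group})
        ((\<lambda>x. x) \<circ> \<rho> \<circ> inv_into U0 \<phi>)"
      using smooth_\<rho> at_one(1) unfolding smooth_map_def open_submanifold_def by fastforce
    ultimately have "Ck_on k (\<phi> ` U0) (\<rho> \<circ> inv_into U0 \<phi>)" for k
      by (simp add: smooth_on_def o_def)
    from Ck_on_affine[OF bl_\<sigma> this, of S e] S(4) show ?thesis
      by (auto simp: smooth_on_def \<gamma>_def S0_def)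
  qed
  obtain R' where R': "\<And>\<theta>. \<theta> \<in> S \<Longrightarrow> ((\<lambda>\<theta>. \<rho> (\<gamma> \<theta>)) has_derivative R' \<theta>) (at \<theta>)"
    by (rule smooth_on_derivative[OF S(1) smooth_R]) (rule that)
  have automorphism: "\<mu> (blinfun_apply (\<rho> (\<gamma> \<theta>)) x) (blinfun_apply (\<rho> (\<gamma> \<theta>)) y) (blinfun_apply (\<rho> (\<gamma> \<theta>)) z) =
      blinfun_apply (\<rho> (\<gamma> \<theta>)) (\<mu> x y z)" if "\<theta> \<in> S" for \<theta> x y z
    using S(1,2) cont_\<gamma> R' S(3) \<gamma>_zero that by (rule automorphism_along)
  have R'0: "((\<lambda>\<theta>. \<rho> (\<gamma> \<theta>)) has_derivative (\<lambda>\<theta>. l (\<sigma> \<theta>))) (at 0)"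
  proof -
    have "((\<lambda>\<theta>. (\<rho> \<circ> inv_into U0 \<phi>) (e + \<sigma> \<theta>)) has_derivative (\<lambda>\<theta>. l (\<sigma> \<theta>))) (at 0)"
    proof (rule has_derivative_in_compose[where f = "\<lambda>\<theta>. e + \<sigma> \<theta>"])
      show "((\<lambda>\<theta>. e + \<sigma> \<theta>) has_derivative \<sigma>) (at 0)"
        by (auto intro!: derivative_eq_intros bounded_linear.has_derivative[OF bl_\<sigma>])
      show "((\<rho> \<circ> inv_into U0 \<phi>) has_derivative l) (at (e + \<sigma> 0) within range (\<lambda>\<theta>. e + \<sigma> \<theta>))"
        unfolding zero add_0_right e_def
        by (rule has_derivative_subset[OF at_one(3)])
          (use \<sigma>(1) \<phi>_one_in_model sub in \<open>auto intro!: subspace_add\<close>)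
    qed
    then show ?thesis by (simp add: \<gamma>_def)
  qed

  define \<Psi> where "\<Psi> \<theta> = \<rho> (\<gamma> \<theta>) o\<^sub>L (f + \<tau> \<theta>)" for \<theta>
  have \<Psi>0: "\<Psi> 0 = f" by (intro blinfun_eqI) (simp add: \<Psi>_def \<gamma>_zero \<rho>_one zero)
  have smooth_\<Psi>: "smooth_on S \<Psi>"
    unfolding smooth_on_def
  proof
    fix k
    have "Ck_on k S (\<lambda>\<theta>. \<rho> (\<gamma> \<theta>))" using smooth_R by (simp only: smooth_on_def)
    moreover have "Ck_on k S (\<lambda>\<theta>. f + \<tau> \<theta>)"
      by (rule Ck_on_add[OF Ck_on_const Ck_on_linear[OF bl_\<tau>]])
    ultimately show "Ck_on k S \<Psi>"
      unfolding \<Psi>_def by (rule Ck_on_bilinear[OF bounded_bilinear_blinfun_compose])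
  qed
  have \<Psi>'0: "(\<Psi> has_derivative (\<lambda>\<theta>. \<theta>)) (at 0)"
  proof -
    have "((\<lambda>\<theta>. f + \<tau> \<theta>) has_derivative \<tau>) (at 0)"
      by (auto intro!: derivative_eq_intros bounded_linear.has_derivative[OF bl_\<tau>])
    from bounded_bilinear.FDERIV[OF bounded_bilinear_blinfun_compose R'0 this]
    have "(\<Psi> has_derivative (\<lambda>\<theta>. (\<rho> (\<gamma> 0) o\<^sub>L \<tau> \<theta>) + (l (\<sigma> \<theta>) o\<^sub>L (f + \<tau> 0)))) (at 0)"
      unfolding \<Psi>_def .
    \<comment> \<open>The two summands are \<open>\<tau> \<theta>\<close> and
      \<open>orb (\<sigma> \<theta>)\<close>, which add up to \<open>\<theta>\<close> by the
      definition of \<open>\<tau>\<close>.\<close>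
    moreover have "(\<rho> (\<gamma> 0) o\<^sub>L \<tau> \<theta>) + (l (\<sigma> \<theta>) o\<^sub>L (f + \<tau> 0)) = \<theta>" for \<theta>
      by (intro blinfun_eqI)
        (simp add: \<gamma>_zero \<rho>_one zero \<tau>_def[of \<theta>] orb_def blinfun.add_left blinfun.diff_left)
    ultimately show ?thesis by simp
  qed
  obtain V H where V: "open V" "f \<in> V" "smooth_on V H" "H ` V \<subseteq> S" "\<And>g. g \<in> V \<Longrightarrow> \<Psi> (H g) = g"
    by (rule smooth_inverse_function[OF finW S(1,3) smooth_\<Psi> \<Psi>'0, unfolded \<Psi>0]) (rule that)

  define p where "p g = \<gamma> (H g)" for g
  have "smooth_map (open_submanifold V) M p"
    unfolding smooth_map_def
  proof (intro conjI)
    have Ck_H: "Ck_on k V H" for k using V(3) by (simp only: smooth_on_def)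
    then have "continuous_on V H" by (rule Ck_on_imp_continuous_on)
    then have "continuous_map (top_of_set V) (top_of_set S) H"
      using V(4) by (auto simp: continuous_map_in_subtopology)
    from continuous_map_compose[OF this cont_\<gamma>]
    show "continuous_map (mtop (open_submanifold V)) (mtop M) p"
      by (simp add: open_submanifold_def p_def[abs_def] o_def)
    have "smooth_on ((\<lambda>x. x) ` {g \<in> V. p g \<in> W}) (\<psi> \<circ> p \<circ> inv_into V (\<lambda>x. x))"
      if W: "(W, \<psi>) \<in> atlas M" for W \<psi>
    proof -
      \<comment> \<open>In the chart \<open>\<psi>\<close>, the map \<open>p\<close> is this
        transition map after \<open>e + \<sigma> \<theta>\<close> after \<open>H\<close>. The affine
        part is absorbed first, so that the composition with \<open>H\<close> passes through the
        finite-dimensional space \<open>Hom\<close>.\<close>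
      have "smooth_on (\<phi> ` (U0 \<inter> W)) (\<psi> \<circ> inv_into U0 \<phi>)"
      proof -
        have "\<forall>(X, \<xi>)\<in>atlas M. \<forall>(W, \<psi>)\<in>atlas M. smooth_on (\<xi> ` (X \<inter> W)) (\<psi> \<circ> inv_into X \<xi>)"
          using manifold unfolding smooth_manifold_def by (elim conjE)
        from bspec[OF this at_one(1), unfolded prod.case, THEN bspec, OF W] show ?thesis
          by (simp only: prod.case)
      qed
      then have "Ck_on k {\<theta>. e + \<sigma> \<theta> \<in> \<phi> ` (U0 \<inter> W)} (\<lambda>\<theta>. (\<psi> \<circ> inv_into U0 \<phi>) (e + \<sigma> \<theta>))" for k
        unfolding smooth_on_def by (intro Ck_on_affine[OF bl_\<sigma>]) (rule spec, assumption, simp)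
      moreover have "Ck_on k {g \<in> V. p g \<in> W} H" for k
        using Ck_H by (rule Ck_on_subset) simp
      moreover have "H g \<in> {\<theta>. e + \<sigma> \<theta> \<in> \<phi> ` (U0 \<inter> W)}" if "g \<in> {g \<in> V. p g \<in> W}" for g
      proof -
        have "H g \<in> S" "\<gamma> (H g) \<in> W" using that V(4) by (auto simp: p_def)
        with \<gamma>_U0[OF this(1)] show ?thesis by (metis IntI imageI mem_Collect_eq)
      qed
      ultimately have "Ck_on k {g \<in> V. p g \<in> W} (\<lambda>g. (\<psi> \<circ> inv_into U0 \<phi>) (e + \<sigma> (H g)))" for k
        by (rule Ck_on_compose[OF finW])
      then have "Ck_on k {g \<in> V. p g \<in> W} (\<psi> \<circ> p \<circ> inv_into V (\<lambda>x. x))" for k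
        by (rule Ck_on_cong) (use inv_into_f_f[of "\<lambda>x. x" V] in \<open>simp add: p_def \<gamma>_def\<close>)
      then show ?thesis by (simp add: smooth_on_def)
    qed
    then show "\<forall>(X, \<xi>)\<in>atlas (open_submanifold V). \<forall>(W, \<psi>)\<in>atlas M.
        smooth_on (\<xi> ` {x \<in> X. p x \<in> W}) (\<psi> \<circ> p \<circ> inv_into X \<xi>)"
      unfolding open_submanifold_def by (simp add: split_beta)
  qed
  moreover have "\<rho> (p g) o\<^sub>L f = g" if "g \<in> V" and g: "three_Lie_morphism \<pi> \<mu> g" for g
  proof -
    define \<theta> where "\<theta> = H g"
    have "\<theta> \<in> S" using V(4) \<open>g \<in> V\<close> by (auto simp: \<theta>_def)
    let ?A = "\<rho> (\<gamma> \<theta>)"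
    have eq: "?A o\<^sub>L (f + \<tau> \<theta>) = g" using V(5)[OF \<open>g \<in> V\<close>] by (simp add: \<Psi>_def \<theta>_def)
    then have eq': "blinfun_apply g x = blinfun_apply ?A (blinfun_apply (f + \<tau> \<theta>) x)" for x
      by (metis blinfun_apply_blinfun_compose)
    have inj: "s = t" if "blinfun_apply ?A s = blinfun_apply ?A t" for s t
      using \<rho>_inv_apply(2)[of "\<gamma> \<theta>"] \<gamma>_U0(1)[OF \<open>\<theta> \<in> S\<close>] U_subset that by (metis subsetD)
    have "three_Lie_morphism \<pi> \<mu> (f + \<tau> \<theta>)"
      unfolding three_Lie_morphism_def
    proof (intro allI)
      fix x y z
      have "blinfun_apply g (\<pi> x y z) = \<mu> (blinfun_apply g x) (blinfun_apply g y) (blinfun_apply g z)"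
        using g by (simp add: three_Lie_morphism_def)
      then show "blinfun_apply (f + \<tau> \<theta>) (\<pi> x y z) = \<mu> (blinfun_apply (f + \<tau> \<theta>) x)
          (blinfun_apply (f + \<tau> \<theta>) y) (blinfun_apply (f + \<tau> \<theta>) z)"
        unfolding eq' automorphism[OF \<open>\<theta> \<in> S\<close>] by (rule inj)
    qed
    then have "\<tau> \<theta> = 0" using r[of "\<tau> \<theta>"] S(5)[OF \<open>\<theta> \<in> S\<close>] by blast
    with eq show ?thesis by (simp add: p_def \<theta>_def)
  qed
  ultimately show ?thesis using V(1,2) by blast
qed

end
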